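(* Let $I=[-1,1]$, let $k\ge1$ be an integer and let $s>1$. If $\psi\in G^s_k(I)$ is real-valued, then $m_\psi(\lambda)=O(\log^{(k+2)}\lambda)$ as $\lambda\to\infty$. This bound is sharp: there exist a real-valued $\psi\in G^s_k(I)$ and a sequence $\lambda_n\to\infty$ such that $$|m_\psi(\lambda_n)|\approx\log^{(k+2)}\lambda_n$$ for all sufficiently large $n$.
   Context: For a real-valued $\psi\in C^1(I)$, $I=[-1,1]$, and $\lambda>0$, the Stein--Wainger oscillatory integral is $m_\psi(\lambda):=\mathrm{p.v.}\int_{-1}^{1}e^{i\lambda\psi(t)}\frac{dt}{t}=\lim_{\varepsilon\to0^+}\int_{\varepsilon\le|t|\le1}e^{i\lambda\psi(t)}\frac{dt}{t}$. $\log^{(j)}$ denotes the $j$-fold iterated logarithm. For $s\ge1$ and an integer $k\ge1$, a function $\psi\in C^\infty(I)$ belongs to the refined Gevrey class $G^s_k(I)$ if there is a constant $K>0$ such that for all sufficiently large $n$, $\sup_{t\in I}|\psi^{(n)}(t)|\le K^{n+1}\,n!\,Q_{k,s}(n)^n$, where $Q_{k,s}(n)=(\log^{(k)}n)^s\prod_{j=1}^{k-1}\log^{(j)}n$ (empty product equal to $1$). Implicit constants may depend on $\psi,k,s$ but not on $\lambda$. $X\approx Y$ means $cY\le X\le CY$ for some constants $c,C>0$ independent of $n$ (and of $\lambda_n$). *)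

theory Defs
  imports "HOL-Analysis.Analysis" "HOL-Library.Landau_Symbols"
begin

(* Derivatives are taken within S, hence one-sided at the endpoints when S is an interval. *)
primrec deriv_within :: "real set \<Rightarrow> nat \<Rightarrow> (real \<Rightarrow> real) \<Rightarrow> real \<Rightarrow> real" where
  "deriv_within S 0 f = f"
| "deriv_within S (Suc n) f = (\<lambda>t. vector_derivative (deriv_within S n f) (at t within S))"

definition smooth_on :: "real set \<Rightarrow> (real \<Rightarrow> real) \<Rightarrow> bool" where
  "smooth_on S f \<longleftrightarrow> (\<forall>n. deriv_within S n f differentiable_on S)"

definition iter_log :: "nat \<Rightarrow> real \<Rightarrow> real" where
  "iter_log j = ln ^^ j"

(* iter_log and powr have their intended meaning once all the iterated logarithms
   involved are positive; Q_weight and iter_log are only used for large arguments. *)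
definition Q_weight :: "nat \<Rightarrow> real \<Rightarrow> nat \<Rightarrow> real" where
  "Q_weight k s n = (iter_log k (real n)) powr s * (\<Prod>j\<in>{1..<k}. iter_log j (real n))"

(* The supremum is that of a continuous function on a compact interval, so it is
   never the unspecified supremum of an unbounded set. *)
definition refined_gevrey :: "nat \<Rightarrow> real \<Rightarrow> (real \<Rightarrow> real) set" where
  "refined_gevrey k s =
     {\<psi>. smooth_on {-1..1} \<psi> \<and>
          (\<exists>K>0. \<forall>\<^sub>F n in sequentially.
             (SUP t\<in>{-1..1}. \<bar>deriv_within {-1..1} n \<psi> t\<bar>)
               \<le> K ^ (n + 1) * fact n * Q_weight k s n ^ n)}"

(* The limit exists for every continuously differentiable phase on [-1,1]. *)
definition stein_wainger :: "(real \<Rightarrow> real) \<Rightarrow> real \<Rightarrow> complex" where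
  "stein_wainger \<psi> x =
     Lim (at_right 0) (\<lambda>\<epsilon>::real. integral {t. \<epsilon> \<le> \<bar>t\<bar> \<and> \<bar>t\<bar> \<le> 1}
       (\<lambda>t. exp (\<i> * of_real (x * \<psi> t)) / of_real t))"

end

theory Submission
  imports Defs
begin

text \<open>
Fold the integral onto the positive half-line: m(\<lambda>) is the integral over (0,1] of
(cis (\<lambda> \<psi>(t)) - cis (\<lambda> \<psi>(-t))) / t.  The integrand is at most 2/t, and at most
\<lambda> |\<psi>(t) - \<psi>(-t)| / t, so near the origin only the odd part of \<psi> matters.

Upper bound.  Suppose first that some derivative of \<psi> of odd order does not vanish at 0, and let m be
the least such order.  The odd part is O(t^m), so the part of the integral below a = \<lambda>^(-1/m) is
bounded; above a and near 0, \<psi>' has the size t^(r-1), where r \<le> m is the least order of any derivative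
not vanishing at 0, and one integration by parts bounds each of the two oscillatory integrals by a constant over \<lambda> a^r \<ge> 1
(\<open>stein_wainger_bounded_nonflat\<close>).  Otherwise the odd part o is flat at 0.
For k \<ge> 2 Taylor's formula at 0 alone would not suffice: the factors log^(j) n in the weight Q have to be
exploited through the convergence of the sum of 1/(n Q(n)), which is what Bang's argument does.
It passes from |o^(n)| \<le> e^(n-N) M_n (n < N) at a point to the same bound with N - 1 on a further stretch
of length about 1/(N Q(N)).  Starting from the flat point with an arbitrarily large index,
|o(t)| = O(t e^(-N)) holds for t up to a multiple of the tail sum over i > N of 1/(i Q(i)), that is,
of (log^(k) N)^(1-s) (\<open>flat_decay\<close>).  With N about log \<lambda> the
integral below this cutoff T is bounded, and the rest is at most
2 log (1/T), which is O(log^(k+2) \<lambda>) (\<open>stein_wainger_bound_flat\<close>).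

Sharpness.  Let \<psi> vanish for t \<le> 0.  Then the real part of the folded integrand is
(cos (\<lambda> \<psi>(t)) - 1)/t, which is never positive, so that contributions cannot cancel.  Take \<psi> to be
constant, equal to \<pi>/3^(N_j), on the interval from 2/4^j to 4/4^j, with smooth steps in between.  For
\<lambda> = 3^(N_n) all phases on the plateaus j \<le> n are odd multiples of \<pi>, so each plateau
contributes -2 log 2 and |m(\<lambda>)| \<ge> 2 n log 2 (\<open>stein_wainger_lower_bound\<close>).
The steps come from a function of the slightly better class with s' = (1+s)/2, which exists because
s' > 1 (\<open>gevrey_step_exists\<close>); compressing it by 4^j costs 4^(jn) in the n-th
derivative, and the gain (log^(k) n)^((s-s')n) pays for this except when n is below a (k+1)-fold
exponential of a multiple of j.  There the height 3^(-N_j) of the step pays, if N_j is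
itself about such a (k+1)-fold exponential (\<open>gevrey_staircase_exists\<close>).
Hence log^(k+2) (3^(N_n)) = O(n), which is the required size.
\<close>

section \<open>Iterated logarithms and the Gevrey weight\<close>

lemma iter_log_0: "iter_log 0 x = x"
  by (simp add: iter_log_def)

lemma iter_log_Suc: "iter_log (Suc j) x = ln (iter_log j x)"
  by (simp add: iter_log_def)

lemma iter_log_Suc': "iter_log (Suc j) x = iter_log j (ln x)"
  by (simp add: iter_log_def funpow_swap1)

definition iter_exp :: "nat \<Rightarrow> real \<Rightarrow> real" where
  "iter_exp m = exp ^^ m"

lemma iter_exp_simps [simp]: "iter_exp 0 x = x" "iter_exp (Suc m) x = exp (iter_exp m x)"
  by (simp_all add: iter_exp_def)

lemma iter_exp_Suc': "iter_exp (Suc m) x = iter_exp m (exp x)"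
  by (simp add: iter_exp_def funpow_swap1)

lemma iter_exp_add: "iter_exp (m + n) x = iter_exp m (iter_exp n x)"
  by (simp add: iter_exp_def funpow_add)

lemma iter_exp_mono: "x \<le> y \<Longrightarrow> iter_exp m x \<le> iter_exp m y"
  by (induction m) auto

lemma iter_exp_ge: "x \<le> iter_exp m x"
proof (induction m)
  case (Suc m)
  have "iter_exp m x \<le> exp (iter_exp m x)" using exp_ge_add_one_self[of "iter_exp m x"] by linarith
  thus ?case using Suc by simp
qed simp

lemma iter_exp_add_le: "y \<ge> 0 \<Longrightarrow> iter_exp m x + y \<le> iter_exp m (x + y)" if "x \<ge> 0"
proof (induction m)
  case (Suc m)
  have "0 \<le> iter_exp m x" using iter_exp_ge[of x m] that by linarith
  hence *: "1 \<le> exp (iter_exp m x)" by simp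
  have "exp (iter_exp m x) + y \<le> exp (iter_exp m x) * (1 + y)"
    using mult_right_mono[OF *, of y] Suc.prems by (simp add: algebra_simps)
  also have "\<dots> \<le> exp (iter_exp m x) * exp y"
    using exp_ge_add_one_self[of y] by (intro mult_left_mono) auto
  also have "\<dots> = exp (iter_exp m x + y)" by (simp add: exp_add)
  also have "\<dots> \<le> exp (iter_exp m (x + y))" using Suc by simp
  finally show ?case by simp
qed simp

text \<open>
Factors in front of an iterated exponential are absorbed by a shift of its argument; this makes
iterated logarithms insensitive to such factors.
\<close>

lemma mult_iter_exp_le:
  assumes "x \<ge> 0" "y \<ge> 0"
  shows "y * iter_exp (Suc m) x \<le> iter_exp (Suc m) (x + y)"
proof -
  have "y \<le> exp y" using exp_ge_add_one_self[of y] by linarith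
  hence "y * exp (iter_exp m x) \<le> exp y * exp (iter_exp m x)"
    by (intro mult_right_mono) auto
  also have "\<dots> = exp (iter_exp m x + y)" by (simp add: exp_add)
  also have "\<dots> \<le> exp (iter_exp m (x + y))" using iter_exp_add_le[OF assms] by simp
  finally show ?thesis by simp
qed

text \<open>
This and the next lemma transport inequalities from iterated exponentials to iterated logarithms.  The
lower bound on x also ensures that every intermediate logarithm has a positive argument.
\<close>

lemma iter_log_ge: "iter_exp m a \<le> x \<Longrightarrow> a \<le> iter_log m x"
proof (induction m arbitrary: x)
  case (Suc m)
  have "x > 0" using Suc.prems exp_gt_zero[of "iter_exp m a"] by (simp del: exp_gt_zero)
  hence "iter_exp m a \<le> ln x" using Suc.prems by (simp add: ln_ge_iff)
  thus ?case using Suc.IH by (simp add: iter_log_Suc')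
qed (simp add: iter_log_0)

lemma iter_log_le: "iter_exp m a \<le> x \<Longrightarrow> x \<le> iter_exp m b \<Longrightarrow> iter_log m x \<le> b"
proof (induction m arbitrary: x)
  case (Suc m)
  have x: "x > 0" using Suc.prems exp_gt_zero[of "iter_exp m a"] by (simp del: exp_gt_zero)
  hence "iter_exp m a \<le> ln x" using Suc.prems by (simp add: ln_ge_iff)
  moreover have "ln x \<le> iter_exp m b" using Suc.prems x ln_le_cancel_iff[of x "exp (iter_exp m b)"] by simp
  ultimately show ?case using Suc.IH by (simp add: iter_log_Suc')
qed (simp add: iter_log_0)

lemma filterlim_iter_log: "filterlim (iter_log m) at_top at_top"
  unfolding filterlim_at_top eventually_at_top_linorder
  using iter_log_ge by blast

lemma iter_log_ge_1: "iter_exp k 1 \<le> x \<Longrightarrow> j \<le> k \<Longrightarrow> 1 \<le> iter_log j x"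
proof -
  assume x: "iter_exp k 1 \<le> x" and j: "j \<le> k"
  have "iter_exp j (iter_exp (k - j) 1) \<le> x" using x j by (simp flip: iter_exp_add)
  hence "iter_exp (k - j) 1 \<le> iter_log j x" by (rule iter_log_ge)
  thus ?thesis using iter_exp_ge[of 1 "k - j"] by linarith
qed

lemma iter_log_mono:
  assumes "iter_exp k 1 \<le> x" "x \<le> y" "j \<le> k"
  shows "iter_log j x \<le> iter_log j y"
  using assms(3)
proof (induction j)
  case (Suc j)
  have "1 \<le> iter_log j x" using iter_log_ge_1[OF assms(1)] Suc.prems by simp
  thus ?case using Suc by (simp add: iter_log_Suc)
qed (simp add: iter_log_0 assms)

text \<open>
Each logarithm contracts ratios: ln u = ln v + ln (u/v) \<le> ln v + (u/v - 1), and u/v - 1 is at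
most (u/v - 1) ln v because ln v \<ge> 1.
\<close>

lemma iter_log_ratio:
  assumes "iter_exp k 1 \<le> x" "x \<le> y" "j \<le> k"
  shows "iter_log j y \<le> y / x * iter_log j x"
  using assms(3)
proof (induction j)
  case 0
  have "x > 0" using assms iter_exp_ge[of 1 k] by linarith
  thus ?case by (simp add: iter_log_0)
next
  case (Suc j)
  define u v where "u = iter_log j y" and "v = iter_log j x"
  have x: "x > 0" using assms iter_exp_ge[of 1 k] by linarith
  have v: "1 \<le> v" "1 \<le> ln v"
    using iter_log_ge_1[OF assms(1), of j] iter_log_ge_1[OF assms(1), of "Suc j"] Suc.prems
    by (simp_all add: v_def iter_log_Suc)
  have uv: "v \<le> u" using iter_log_mono[OF assms(1,2), of j] Suc.prems by (simp add: u_def v_def)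
  have q: "u / v \<le> y / x" using Suc v by (simp add: u_def v_def field_simps)
  have "ln u = ln v + ln (u / v)" using v uv by (simp add: ln_div)
  also have "\<dots> \<le> ln v + (u / v - 1)" using ln_le_minus_one[of "u / v"] v uv by simp
  also have "\<dots> \<le> ln v + (u / v - 1) * ln v"
    using mult_left_mono[OF v(2), of "u / v - 1"] v uv by simp
  also have "\<dots> = u / v * ln v" by (simp add: algebra_simps)
  also have "\<dots> \<le> y / x * ln v" using q v by (intro mult_right_mono) auto
  finally show ?case by (simp add: iter_log_Suc u_def v_def)
qed

text \<open>
The weight Q as a function of a real argument, so that it can be compared with an integral.
\<close>

definition weight :: "nat \<Rightarrow> real \<Rightarrow> real \<Rightarrow> real" where
  "weight k s x = iter_log k x powr s * (\<Prod>j\<in>{1..<k}. iter_log j x)"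

lemma Q_weight_eq: "Q_weight k s n = weight k s (real n)"
  by (simp add: Q_weight_def weight_def)

lemma weight_ge_1:
  assumes "iter_exp k 1 \<le> x" "s \<ge> 0"
  shows "1 \<le> weight k s x"
proof -
  have "1 \<le> iter_log k x powr s" using iter_log_ge_1[OF assms(1), of k] assms ge_one_powr_ge_zero by simp
  moreover have "1 \<le> (\<Prod>j\<in>{1..<k}. iter_log j x)"
    using iter_log_ge_1[OF assms(1)] by (intro prod_ge_1) auto
  ultimately show ?thesis unfolding weight_def by (metis mult_mono' mult_1 zero_le_one)
qed

lemma weight_mono:
  assumes "iter_exp k 1 \<le> x" "x \<le> y" "s \<ge> 0"
  shows "weight k s x \<le> weight k s y"
  unfolding weight_def
proof (intro mult_mono powr_mono2 prod_mono conjI prod_nonneg)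
  fix j assume "j \<in> {1..<k}"
  thus "0 \<le> iter_log j x" "iter_log j x \<le> iter_log j y"
    using iter_log_ge_1[OF assms(1), of j] iter_log_mono[OF assms(1,2), of j] by auto
next
  show "0 \<le> iter_log k x" "iter_log k x \<le> iter_log k y"
    using iter_log_ge_1[OF assms(1), of k] iter_log_mono[OF assms(1,2), of k] by auto
next
  fix j assume "j \<in> {1..<k}"
  thus "0 \<le> iter_log j x"
    using iter_log_ge_1[OF assms(1), of j] by auto
qed (use assms in auto)

text \<open>
Each logarithm contributes a factor y/x.  Growth like a power is what keeps Q(m)^n / Q(n)^n below
C^(m-n) in Bang's argument.
\<close>

lemma weight_ratio:
  assumes "iter_exp k 1 \<le> x" "x \<le> y" "s \<ge> 0"
  shows "weight k s y \<le> (y / x) powr (s + real (k - 1)) * weight k s x"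
proof -
  have x: "x > 0" using assms iter_exp_ge[of 1 k] by linarith
  have y: "iter_exp k 1 \<le> y" using assms by simp
  have "weight k s y \<le> (y / x * iter_log k x) powr s * (\<Prod>j\<in>{1..<k}. y / x * iter_log j x)"
    unfolding weight_def
  proof (intro mult_mono powr_mono2 prod_mono conjI prod_nonneg)
    fix j assume j: "j \<in> {1..<k}"
    show "0 \<le> iter_log j y" "iter_log j y \<le> y / x * iter_log j x"
      using iter_log_ge_1[OF y, of j] iter_log_ratio[OF assms(1,2), of j] j by auto
    show "0 \<le> iter_log j y" by fact
  next
    show "0 \<le> iter_log k y" "iter_log k y \<le> y / x * iter_log k x"
      using iter_log_ge_1[OF y, of k] iter_log_ratio[OF assms(1,2), of k] by auto
  qed (use assms in auto)
  also have "\<dots> = (y / x) powr (s + real (k - 1)) * weight k s x"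
    using x assms(2) iter_log_ge_1[OF assms(1), of k]
    by (simp add: weight_def powr_mult powr_add prod.distrib prod_dividef powr_realpow powr_divide)
  finally show ?thesis .
qed

lemma has_derivative_iter_log:
  assumes "iter_exp k 1 \<le> x" "1 \<le> j" "j \<le> k"
  shows "(iter_log j has_real_derivative 1 / (x * (\<Prod>i\<in>{1..<j}. iter_log i x))) (at x)"
  using assms(2,3)
proof (induction j rule: nat_induct_at_least)
  case base
  have "x > 0" using assms iter_exp_ge[of 1 k] by linarith
  moreover have "iter_log 1 = ln" by (simp add: iter_log_def)
  ultimately show ?case by (auto intro!: derivative_eq_intros)
next
  case (Suc j)
  have pos: "iter_log j x > 0" using iter_log_ge_1[OF assms(1), of j] Suc by simp
  have "((\<lambda>x. ln (iter_log j x)) has_real_derivative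
      1 / iter_log j x * (1 / (x * (\<Prod>i\<in>{1..<j}. iter_log i x)))) (at x)"
    using Suc pos by (intro derivative_eq_intros | simp)+
  moreover have "(\<Prod>i\<in>{1..<Suc j}. iter_log i x) = (\<Prod>i\<in>{1..<j}. iter_log i x) * iter_log j x"
    using Suc by (simp add: prod.atLeastLessThan_Suc)
  ultimately show ?case by (simp add: iter_log_Suc[abs_def] mult_ac)
qed

text \<open>
Minus an antiderivative of 1/(x Q(x)): it measures the tail of the convergent series of 1/(n Q(n)).
\<close>

definition weight_tail :: "nat \<Rightarrow> real \<Rightarrow> real \<Rightarrow> real" where
  "weight_tail k s x = iter_log k x powr (1 - s) / (s - 1)"

lemma has_derivative_weight_tail:
  assumes "iter_exp k 1 \<le> x" "1 \<le> k" "s > 1"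
  shows "(weight_tail k s has_real_derivative - (1 / (x * weight k s x))) (at x)"
proof -
  define P where "P = (\<Prod>i\<in>{1..<k}. iter_log i x)"
  have l: "iter_log k x > 0" using iter_log_ge_1[OF assms(1), of k] by simp
  have d: "(iter_log k has_real_derivative 1 / (x * P)) (at x)"
    using has_derivative_iter_log[OF assms(1)] assms unfolding P_def by auto
  have "((\<lambda>x. iter_log k x powr (1 - s)) has_real_derivative (1 - s) * iter_log k x powr (1 - s - 1) * (1 / (x * P))) (at x)"
    by (rule DERIV_chain2[OF has_real_derivative_powr[OF l] d])
  hence "(weight_tail k s has_real_derivative (1 - s) * iter_log k x powr (- s) * (1 / (x * P)) / (s - 1)) (at x)"
    unfolding weight_tail_def[abs_def] by (rule DERIV_cdivide[THEN DERIV_cong]) simp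
  moreover have "(1 - s) * iter_log k x powr (- s) * (1 / (x * P)) / (s - 1) = - (1 / (x * weight k s x))"
  proof -
    have "(1 - s) * A / (s - 1) = - A" for A using assms by (simp add: field_simps)
    from this[of "iter_log k x powr (- s) * (1 / (x * P))"] show ?thesis
      by (simp add: weight_def P_def powr_minus field_simps)
  qed
  ultimately show ?thesis by simp
qed

text \<open>
The mean value theorem gives 1/(z Q(z)) at an intermediate point z, and x Q(x) is increasing.
\<close>

lemma weight_tail_diff_bounds:
  assumes "iter_exp k 1 \<le> a" "a < b" "1 \<le> k" "s > 1"
  shows "(b - a) / (b * weight k s b) \<le> weight_tail k s a - weight_tail k s b"
    and "weight_tail k s a - weight_tail k s b \<le> (b - a) / (a * weight k s a)"
proof -
  have a: "a > 0" using assms iter_exp_ge[of 1 k] by linarith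
  obtain z where z: "a < z" "z < b" "weight_tail k s b - weight_tail k s a = (b - a) * (- (1 / (z * weight k s z)))"
    using MVT2[OF assms(2), of "weight_tail k s" "\<lambda>x. - (1 / (x * weight k s x))"] has_derivative_weight_tail assms
    by (metis dual_order.trans)
  have w: "1 \<le> weight k s a" "weight k s a \<le> weight k s z" "weight k s z \<le> weight k s b"
    using weight_ge_1[of k a s] weight_mono[of k a z s] weight_mono[of k z b s] assms z by auto
  have eq: "weight_tail k s a - weight_tail k s b = (b - a) / (z * weight k s z)" using z by (simp add: field_simps)
  show "(b - a) / (b * weight k s b) \<le> weight_tail k s a - weight_tail k s b"
    unfolding eq using a z w assms by (intro divide_left_mono mult_mono mult_pos_pos) auto
  show "weight_tail k s a - weight_tail k s b \<le> (b - a) / (a * weight k s a)"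
    unfolding eq using a z w assms by (intro divide_left_mono mult_mono mult_pos_pos) auto
qed

lemma weight_tail_tendsto_0:
  assumes "s > 1"
  shows "(weight_tail k s \<longlongrightarrow> 0) at_top"
proof -
  have "((\<lambda>x. iter_log k x powr (1 - s)) \<longlongrightarrow> 0) at_top"
    using assms by (intro tendsto_neg_powr filterlim_iter_log) auto
  thus ?thesis unfolding weight_tail_def[abs_def] by (rule tendsto_divide_zero)
qed

text \<open>
The left side divided by n! is a single term of the exponential series.
\<close>

lemma power_self_le_exp_fact: "real n ^ n \<le> exp (real n) * fact n"
proof -
  have "real n ^ n /\<^sub>R fact n \<le> exp (real n)"
    unfolding exp_def using sum_le_suminf[OF summable_exp_generic[of "real n"], of "{n}"] by simp
  thus ?thesis by (simp add: field_simps)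
qed

section \<open>Decay of flat functions (Bang)\<close>

text \<open>
One step of Bang's argument.  Taylor's formula at x, up to order N, expresses f_n(x+h) through
derivatives that are all at most e^(n+j-N) M_(n+j): for n + j < N by the hypothesis at x, and for the
remainder of order N by the global bound.  The ratio condition turns the terms into
e^(n-N) M_n (e h \<nu>)^j / j!, so for e h \<nu> \<le> 1 the sum costs at most a factor e, which is one unit of N.
\<close>

lemma bang_step:
  fixes f :: "nat \<Rightarrow> real \<Rightarrow> real" and M :: "nat \<Rightarrow> real"
  assumes deriv: "\<And>n t. n0 \<le> n \<Longrightarrow> x \<le> t \<Longrightarrow> t \<le> x + h \<Longrightarrow> (f n has_real_derivative f (Suc n) t) (at t)"
    and bound: "\<And>n t. n0 \<le> n \<Longrightarrow> x \<le> t \<Longrightarrow> t \<le> x + h \<Longrightarrow> \<bar>f n t\<bar> \<le> M n"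
    and ratio: "\<And>n j. n0 \<le> n \<Longrightarrow> n + j \<le> N \<Longrightarrow> M (n + j) \<le> M n * \<nu> ^ j"
    and small: "\<And>n. n0 \<le> n \<Longrightarrow> n < N \<Longrightarrow> \<bar>f n x\<bar> \<le> exp (real n - real N) * M n"
    and h: "0 \<le> h" "h * \<nu> * exp 1 \<le> 1" and "\<nu> \<ge> 0"
    and n: "n0 \<le> n" "n < N"
  shows "\<bar>f n (x + h)\<bar> \<le> exp (real n - (real N - 1)) * M n"
proof -
  have Mn: "0 \<le> M n" using bound[of n x] n h by fastforce
  define B where "B = exp (real n - real N) * M n"
  have B: "0 \<le> B" using Mn by (simp add: B_def)
  have key: "c / fact j * h ^ j \<le> B * (1 / fact j)"
    if "c \<le> exp (real (n + j) - real N) * M (n + j)" "n + j \<le> N" for c j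
  proof -
    have "c * h ^ j \<le> exp (real (n + j) - real N) * (M n * \<nu> ^ j) * h ^ j"
      using that ratio[of n j] n h by (smt (verit) exp_gt_zero mult_left_mono mult_right_mono zero_le_power)
    also have "exp (real (n + j) - real N) = exp (real n - real N) * exp 1 ^ j"
      by (simp add: exp_diff exp_add flip: exp_of_nat_mult)
    also have "exp (real n - real N) * exp 1 ^ j * (M n * \<nu> ^ j) * h ^ j = B * (h * \<nu> * exp 1) ^ j"
      by (simp add: B_def power_mult_distrib mult_ac)
    also have "\<dots> \<le> B * 1"
      using h assms(7) B by (intro mult_left_mono power_le_one) auto
    finally have "c * h ^ j \<le> B" by simp
    thus ?thesis by (simp add: divide_right_mono)
  qed
  show ?thesis
  proof (cases "h = 0")
    case True
    have "exp (real n - real N) * M n \<le> exp (real n - (real N - 1)) * M n"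
      using Mn by (intro mult_right_mono) auto
    thus ?thesis using True small[OF n] by simp
  next
    case False
    hence hpos: "h > 0" using h by simp
    define d where "d = N - n"
    have d: "d > 0" "n + d = N" using n by (auto simp: d_def)
    obtain z where z: "0 < z" "z < h" and
      eq: "f n (x + h) = (\<Sum>m<d. f (n + m) (x + 0) / fact m * h ^ m) + f (n + d) (x + z) / fact d * h ^ d"
    proof -
      have "\<exists>t>0. t < h \<and> f n (x + h) =
         (\<Sum>m<d. (\<lambda>m t. f (n + m) (x + t)) m 0 / fact m * h ^ m) + (\<lambda>m t. f (n + m) (x + t)) d t / fact d * h ^ d"
      proof (rule Maclaurin[OF hpos d(1)])
        show "\<forall>m t. m < d \<and> 0 \<le> t \<and> t \<le> h \<longrightarrow>
          ((\<lambda>t. f (n + m) (x + t)) has_real_derivative f (n + Suc m) (x + t)) (at t)"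
        proof (intro allI impI)
          fix m t assume "m < d \<and> 0 \<le> t \<and> t \<le> h"
          hence "(f (n + m) has_real_derivative f (n + Suc m) (t + x)) (at (t + x))"
            using deriv[of "n + m" "t + x"] n by simp
          thus "((\<lambda>t. f (n + m) (x + t)) has_real_derivative f (n + Suc m) (x + t)) (at t)"
            using DERIV_shift[of "f (n + m)" _ t x] by (simp add: add.commute)
        qed
      qed simp
      thus ?thesis using that by auto
    qed
    have "\<bar>f n (x + h)\<bar> \<le> (\<Sum>m<d. \<bar>f (n + m) x / fact m * h ^ m\<bar>) + \<bar>f (n + d) (x + z) / fact d * h ^ d\<bar>"
      unfolding eq add_0_right by (rule order.trans[OF abs_triangle_ineq add_right_mono[OF sum_abs]])
    also have "\<dots> = (\<Sum>m<d. \<bar>f (n + m) x\<bar> / fact m * h ^ m) + \<bar>f (n + d) (x + z)\<bar> / fact d * h ^ d"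
      using h by (simp add: abs_mult)
    also have "\<dots> \<le> (\<Sum>m<d. B * (1 / fact m)) + B * (1 / fact d)"
    proof (intro add_mono sum_mono key)
      fix m assume "m \<in> {..<d}"
      thus "\<bar>f (n + m) x\<bar> \<le> exp (real (n + m) - real N) * M (n + m)" "n + m \<le> N"
        using small[of "n + m"] d n by auto
    next
      show "\<bar>f (n + d) (x + z)\<bar> \<le> exp (real (n + d) - real N) * M (n + d)"
        using bound[of "n + d" "x + z"] d n z by simp
    qed (use d in auto)
    also have "\<dots> = B * (\<Sum>m<Suc d. 1 / fact m)" by (simp add: sum_distrib_left distrib_left)
    also have "\<dots> \<le> B * exp 1"
    proof (rule mult_left_mono[OF _ B])
      have "(\<Sum>m<Suc d. 1 ^ m /\<^sub>R fact m) \<le> (exp 1 :: real)"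
        unfolding exp_def by (rule sum_le_suminf[OF summable_exp_generic]) auto
      thus "(\<Sum>m<Suc d. 1 / fact m) \<le> (exp 1 :: real)" by (simp add: inverse_eq_divide)
    qed
    also have "\<dots> = exp (real n - (real N - 1)) * M n"
      by (simp add: B_def exp_diff)
    finally show ?thesis .
  qed
qed

text \<open>
The steps are chained downwards from J to N.  At the flat point 0 the bound holds with every index J, so
the distance that can be covered before the index drops to N is the full sum of the
step lengths; it approaches a tail of a convergent series as J grows.
\<close>

lemma bang_decay:
  fixes f :: "nat \<Rightarrow> real \<Rightarrow> real" and M \<nu> :: "nat \<Rightarrow> real"
  assumes deriv: "\<And>n t. n0 \<le> n \<Longrightarrow> 0 \<le> t \<Longrightarrow> t < 1 \<Longrightarrow> (f n has_real_derivative f (Suc n) t) (at t)"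
    and bound: "\<And>n t. n0 \<le> n \<Longrightarrow> 0 \<le> t \<Longrightarrow> t < 1 \<Longrightarrow> \<bar>f n t\<bar> \<le> M n"
    and ratio: "\<And>n j N. n0 \<le> n \<Longrightarrow> n + j \<le> N \<Longrightarrow> M (n + j) \<le> M n * \<nu> N ^ j"
    and pos: "\<And>N. n0 \<le> N \<Longrightarrow> \<nu> N > 0"
    and flat: "\<And>n. n0 \<le> n \<Longrightarrow> f n 0 = 0"
    and "n0 \<le> N" "N \<le> J" "0 \<le> x" "x < 1" "x \<le> (\<Sum>i\<in>{N<..J}. 1 / (\<nu> i * exp 1))"
    and "n0 \<le> n" "n < N"
  shows "\<bar>f n x\<bar> \<le> exp (real n - real N) * M n"
  using assms(7,6,8-)
proof (induction N arbitrary: x n rule: inc_induct)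
  case base
  hence "x = 0" by simp
  thus ?case using flat[of n] bound[of n 0] base by simp
next
  case (step N)
  define c where "c = 1 / (\<nu> (Suc N) * exp 1)"
  define x' where "x' = max 0 (x - c)"
  have \<nu>: "\<nu> (Suc N) > 0" using pos[of "Suc N"] step.prems by simp
  hence c: "c > 0" by (simp add: c_def)
  have "{N<..J} = insert (Suc N) {Suc N<..J}" using step.hyps by auto
  hence sum: "(\<Sum>i\<in>{N<..J}. 1 / (\<nu> i * exp 1)) = c + (\<Sum>i\<in>{Suc N<..J}. 1 / (\<nu> i * exp 1))"
    by (simp add: c_def)
  have nn: "0 \<le> (\<Sum>i\<in>{Suc N<..J}. 1 / (\<nu> i * exp 1))"
    using pos step.prems by (intro sum_nonneg) (simp add: less_imp_le)
  have x': "0 \<le> x'" "x' \<le> x" "x - x' \<le> c" "x' \<le> (\<Sum>i\<in>{Suc N<..J}. 1 / (\<nu> i * exp 1))"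
    using step.prems sum nn c by (auto simp: x'_def)
  have "\<bar>f n (x' + (x - x'))\<bar> \<le> exp (real n - (real (Suc N) - 1)) * M n"
  proof (rule bang_step[where ?n0.0 = n0 and \<nu> = "\<nu> (Suc N)"])
    show "(x - x') * \<nu> (Suc N) * exp 1 \<le> 1"
      using x'(3) \<nu> by (simp add: c_def field_simps)
    show "\<bar>f m x'\<bar> \<le> exp (real m - real (Suc N)) * M m" if "n0 \<le> m" "m < Suc N" for m
      using step.IH[of x' m] x' step.prems that by simp
  qed (use deriv bound ratio \<nu> x' step.prems in auto)
  thus ?case by simp
qed

text \<open>
The ratio condition for M_n = (K n Q(n))^n.  This sequence need not be logarithmically convex, but
(m/n)^n \<le> e^(m-n) and the power growth of Q make the failure only a factor exp (1 + s + k) per step.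
\<close>

lemma weighted_power_ratio:
  assumes k: "iter_exp k 1 \<le> real n" "s \<ge> 0" "K > 0" "n + j \<le> N"
  defines "g \<equiv> \<lambda>n. K * real n * weight k s (real n)"
  shows "g (n + j) ^ (n + j) \<le> g n ^ n * (exp (1 + s + real k) * g N) ^ j"
proof -
  \<comment> \<open>The exponent of the power that dominates the growth of Q.\<close>
  define p where "p = s + real (k - 1)"
  have n: "real n \<ge> 1" using k iter_exp_ge[of 1 k] by linarith
  have w: "1 \<le> weight k s (real n)" "1 \<le> weight k s (real (n + j))" 
      "weight k s (real (n + j)) \<le> weight k s (real N)"
    using weight_ge_1[of k "real n" s] weight_ge_1[of k "real (n + j)" s] 
      weight_mono[of k "real (n + j)" "real N" s] k by auto
  have g: "0 \<le> g n" "0 \<le> g (n + j)" using w k by (auto simp: g_def)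
  have gN: "g (n + j) \<le> g N" unfolding g_def using k w by (intro mult_mono) auto
  have q: "1 \<le> real (n + j) / real n" using n by simp
  have 1: "g (n + j) \<le> (real (n + j) / real n) powr (1 + p) * g n"
  proof -
    have "g (n + j) \<le> K * real (n + j) * ((real (n + j) / real n) powr p * weight k s (real n))"
      unfolding g_def p_def using weight_ratio[of k "real n" "real (n + j)" s] k
      by (intro mult_left_mono) auto
    also have "\<dots> = (real (n + j) / real n) powr (1 + p) * g n"
      using n q by (simp add: powr_add g_def)
    finally show ?thesis .
  qed
  have 2: "((real (n + j) / real n) powr (1 + p)) ^ n \<le> exp (1 + s + real k) ^ j"
  proof -
    have "real (n + j) / real n = 1 + real j / real n" using n by (simp add: field_simps)
    also have "\<dots> \<le> exp (real j / real n)" by simp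
    finally have "((real (n + j) / real n) powr (1 + p)) ^ n \<le> (exp (real j / real n) powr (1 + p)) ^ n"
      using k by (intro power_mono powr_mono2) (auto simp: p_def)
    also have "\<dots> = exp (real j * (1 + p))"
      using n by (simp add: exp_powr_real field_simps flip: exp_of_nat_mult)
    also have "\<dots> \<le> exp (real j * (1 + s + real k))" by (simp add: p_def mult_left_mono)
    finally show ?thesis by (simp add: exp_of_nat_mult)
  qed
  have "g (n + j) ^ (n + j) = g (n + j) ^ n * g (n + j) ^ j" by (simp add: power_add)
  also have "\<dots> \<le> ((real (n + j) / real n) powr (1 + p) * g n) ^ n * g N ^ j"
    using 1 gN g by (intro mult_mono power_mono) auto
  also have "\<dots> \<le> exp (1 + s + real k) ^ j * g n ^ n * g N ^ j"
    unfolding power_mult_distrib using 2 g gN by (intro mult_mono) auto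
  finally show ?thesis by (simp add: power_mult_distrib mult_ac)
qed

text \<open>
For n = 0 the point z = t works, which spares the case distinction for orders one and two later on.
\<close>

lemma taylor_flat:
  fixes f :: "nat \<Rightarrow> real \<Rightarrow> real"
  assumes "\<And>m z. 0 \<le> z \<Longrightarrow> z \<le> t \<Longrightarrow> (f m has_real_derivative f (Suc m) z) (at z)"
    and "\<And>m. m < n \<Longrightarrow> f m 0 = 0" and "0 < t"
  obtains z where "0 < z" "z \<le> t" "f 0 t = f n z / fact n * t ^ n"
proof (cases "n = 0")
  case True
  thus ?thesis using that[of t] assms(3) by simp
next
  case False
  have "\<exists>z>0. z < t \<and> f 0 t = (\<Sum>m<n. f m 0 / fact m * t ^ m) + f n z / fact n * t ^ n"
    by (rule Maclaurin) (use assms False in auto)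
  thus ?thesis using that assms(2) by fastforce
qed

text \<open>
Bang's argument is run from the order n0 on where the Gevrey bound is known; it controls the derivative
of order n0, and Taylor's formula at the flat point brings the bound down to the function itself, together
with a factor x that makes the bound integrable against dx/x.
\<close>

lemma flat_decay:
  fixes f :: "nat \<Rightarrow> real \<Rightarrow> real"
  assumes deriv: "\<And>n t. 0 \<le> t \<Longrightarrow> t < 1 \<Longrightarrow> (f n has_real_derivative f (Suc n) t) (at t)"
    and bound: "\<forall>\<^sub>F n in sequentially. \<forall>t\<in>{0..<1}. \<bar>f n t\<bar> \<le> K ^ (n + 1) * fact n * weight k s (real n) ^ n"
    and flat: "\<And>n. f n 0 = 0"
    and "K > 0" "k \<ge> 1" "s > 1"
  obtains c C where "c > 0" "C > 0"
    "\<forall>\<^sub>F N in sequentially. \<forall>x\<in>{0..<1}. x \<le> c * weight_tail k s (real N) \<longrightarrow> \<bar>f 0 x\<bar> \<le> C * x * exp (- real N)"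
proof -
  obtain n1 where n1: "\<And>n t. n1 \<le> n \<Longrightarrow> 0 \<le> t \<Longrightarrow> t < 1 \<Longrightarrow> 
     \<bar>f n t\<bar> \<le> K ^ (n + 1) * fact n * weight k s (real n) ^ n"
    using bound unfolding eventually_sequentially by fastforce
  define n0 where "n0 = max (max 1 n1) (nat \<lceil>iter_exp k 1\<rceil>)"
  have n0: "n0 \<ge> 1" "\<And>n. n0 \<le> n \<Longrightarrow> n1 \<le> n" "\<And>n. n0 \<le> n \<Longrightarrow> iter_exp k 1 \<le> real n"
    by (auto simp: n0_def)
  define g where "g n = K * real n * weight k s (real n)" for n
  define M where "M n = K * g n ^ n" for n
  define \<nu> where "\<nu> n = exp (1 + s + real k) * g n" for n
  have w1: "1 \<le> weight k s (real n)" if "n0 \<le> n" for n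
    using weight_ge_1[of k "real n" s] n0(3)[OF that] assms by simp
  have gpos: "g n > 0" if "n0 \<le> n" for n
    using w1[OF that] that n0(1) assms by (simp add: g_def)
  have bM: "\<bar>f n t\<bar> \<le> M n" if "n0 \<le> n" "0 \<le> t" "t < 1" for n t
  proof -
    have "\<bar>f n t\<bar> \<le> K ^ (n + 1) * fact n * weight k s (real n) ^ n"
      using n1[of n t] n0(2)[of n] that by simp
    also have "\<dots> \<le> K ^ (n + 1) * real n ^ n * weight k s (real n) ^ n"
      using fact_le_power[of n, where ?'a = real] w1[of n] that assms
      by (intro mult_right_mono mult_left_mono) (auto simp: fact_le_power)
    also have "\<dots> = M n" by (simp add: M_def g_def power_mult_distrib)
    finally show ?thesis .
  qed
  \<comment> \<open>The ratio between the step lengths 1/(e \<nu> i) and 1/(i Q(i)).\<close>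
  define c1 where "c1 = 1 / (exp (1 + s + real k) * K * exp 1)"
  have c1: "c1 > 0" using assms by (simp add: c1_def)
  have main: "\<bar>f 0 x\<bar> \<le> exp (real n0) * M n0 * x * exp (- real N)"
    if N: "Suc n0 \<le> N" and x: "0 \<le> x" "x < 1" "x \<le> c1 * (weight_tail k s (real (Suc N)) / 2)" for N x
  proof (cases "x = 0")
    case True thus ?thesis using flat[of 0] by simp
  next
    case False
    have tpos: "weight_tail k s (real (Suc N)) > 0"
      using iter_log_ge_1[of k "real (Suc N)" k] n0(3)[of "Suc N"] N assms
      by (simp add: weight_tail_def)
    have "((\<lambda>J. weight_tail k s (real (Suc J))) \<longlongrightarrow> 0) sequentially"
      by (rule filterlim_compose[OF weight_tail_tendsto_0[OF assms(6)]])
         (rule filterlim_compose[OF filterlim_real_sequentially filterlim_Suc])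
    hence "\<forall>\<^sub>F J in sequentially. weight_tail k s (real (Suc J)) < weight_tail k s (real (Suc N)) / 2"
      using tpos by (intro order_tendstoD) auto
    \<comment> \<open>Far enough out, finitely many steps cover half of the whole tail.\<close>
    then obtain J where J: "N \<le> J" "weight_tail k s (real (Suc J)) < weight_tail k s (real (Suc N)) / 2"
      unfolding eventually_sequentially by (meson nle_le)
    have tele: "weight_tail k s (real (Suc N)) - weight_tail k s (real (Suc J)) \<le> (\<Sum>i\<in>{N<..J}. 1 / (real i * weight k s (real i)))"
      using J(1)
    proof (induction J rule: dec_induct)
      case (step J)
      have "weight_tail k s (real (Suc J)) - weight_tail k s (real (Suc (Suc J))) \<le> 
          (real (Suc (Suc J)) - real (Suc J)) / (real (Suc J) * weight k s (real (Suc J)))"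
        using n0(3)[of "Suc J"] step N assms by (intro weight_tail_diff_bounds) auto
      moreover have "{N<..Suc J} = insert (Suc J) {N<..J}" using step by auto
      ultimately show ?case using step by simp
    qed simp
    have small: "x \<le> (\<Sum>i\<in>{N<..J}. 1 / (\<nu> i * exp 1))"
    proof -
      have "x \<le> c1 * (weight_tail k s (real (Suc N)) - weight_tail k s (real (Suc J)))"
        by (rule order.trans[OF x(3)]) (use c1 J in \<open>intro mult_left_mono, auto\<close>)
      also have "\<dots> \<le> c1 * (\<Sum>i\<in>{N<..J}. 1 / (real i * weight k s (real i)))"
        using tele c1 by (intro mult_left_mono) auto
      also have "\<dots> = (\<Sum>i\<in>{N<..J}. 1 / (\<nu> i * exp 1))"
        by (simp add: sum_distrib_left c1_def \<nu>_def g_def mult_ac)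
      finally show ?thesis .
    qed
    obtain t where t: "0 < t" "t \<le> x" "f 0 x = f n0 t / fact n0 * x ^ n0"
      by (rule taylor_flat[of x f n0]) (use x False deriv flat in auto)
    have "\<bar>f n0 t\<bar> \<le> exp (real n0 - real N) * M n0"
    proof (rule bang_decay[where f = f and x = t and n = n0 and J = J and \<nu> = \<nu> and ?n0.0 = n0])
      show "M (n + j) \<le> M n * \<nu> N' ^ j" if "n0 \<le> n" "n + j \<le> N'" for n j N'
        using weighted_power_ratio[of k n s K j N'] n0(3)[OF that(1)] that assms
        by (simp add: M_def \<nu>_def g_def mult_ac)
    qed (use t x small deriv bM flat J N gpos in \<open>auto simp: \<nu>_def\<close>)
    hence "\<bar>f 0 x\<bar> \<le> exp (real n0 - real N) * M n0 / fact n0 * x ^ n0"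
      using x by (simp add: t(3) abs_mult divide_right_mono mult_right_mono)
    also have "\<dots> \<le> exp (real n0 - real N) * M n0 / 1 * x ^ 1"
      using x n0(1) bM[of n0 0] by (intro mult_mono divide_left_mono power_decreasing) (auto simp: fact_ge_1)
    finally show ?thesis by (simp add: exp_diff exp_minus field_simps)
  qed
  define C where "C = exp (real n0 + 1) * M n0"
  have "C > 0" using gpos[of n0] assms by (simp add: C_def M_def)
  moreover have "\<forall>\<^sub>F N in sequentially. \<forall>x\<in>{0..<1}. x \<le> c1 / 2 * weight_tail k s (real N) \<longrightarrow> \<bar>f 0 x\<bar> \<le> C * x * exp (- real N)"
    unfolding eventually_sequentially
  proof (intro exI[of _ "n0 + 2"] allI impI ballI)
    fix N :: nat and x :: real assume N: "n0 + 2 \<le> N" and x: "x \<in> {0..<1}" "x \<le> c1 / 2 * weight_tail k s (real N)"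
    have "\<bar>f 0 x\<bar> \<le> exp (real n0) * M n0 * x * exp (- real (N - 1))"
      by (rule main) (use N x in auto)
    also have "\<dots> = C * x * exp (- real N)"
      using N by (simp add: C_def exp_add exp_diff exp_minus inverse_eq_divide mult_ac)
    finally show "\<bar>f 0 x\<bar> \<le> C * x * exp (- real N)" .
  qed
  ultimately show ?thesis using that[of "c1 / 2" C] c1 by simp
qed

section \<open>Folding the principal value onto the half-line\<close>

lemma smooth_on_has_derivative:
  assumes "smooth_on S f" "t \<in> S"
  shows "(deriv_within S n f has_real_derivative deriv_within S (Suc n) f t) (at t within S)"
  using assms by (auto simp: smooth_on_def differentiable_on_def vector_derivative_works
      has_real_derivative_iff_has_vector_derivative)

lemma smooth_on_DERIV:
  assumes "smooth_on {-1..1} f" "\<bar>t\<bar> < 1"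
  shows "(deriv_within {-1..1} n f has_real_derivative deriv_within {-1..1} (Suc n) f t) (at t)"
proof -
  have "t \<in> interior {-1..1}" using assms by auto
  thus ?thesis using smooth_on_has_derivative[OF assms(1), of t n] assms(2) at_within_interior[of t "{-1..1}"]
    by (metis interior_subset subsetD)
qed

lemma smooth_on_continuous:
  assumes "smooth_on {-1..1} f"
  shows "continuous_on {-1..1} (deriv_within {-1..1} n f)"
  using assms by (simp add: smooth_on_def differentiable_imp_continuous_on)

text \<open>
The iterated one-sided derivatives depend on the values inside the interval only, so any sequence of
successive derivatives on the interval computes them.
\<close>

lemma deriv_within_eqI:
  fixes f :: "nat \<Rightarrow> real \<Rightarrow> real"
  assumes "\<And>n t. t \<in> {a..b} \<Longrightarrow> (f n has_real_derivative f (Suc n) t) (at t within {a..b})"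
    and "a < b" "t \<in> {a..b}"
  shows "deriv_within {a..b} n (f 0) t = f n t"
  using assms(3)
proof (induction n arbitrary: t)
  case (Suc n)
  have "(f n has_vector_derivative f (Suc n) t) (at t within {a..b})"
    using assms(1)[OF Suc.prems] by (simp add: has_real_derivative_iff_has_vector_derivative)
  hence "(deriv_within {a..b} n (f 0) has_vector_derivative f (Suc n) t) (at t within {a..b})"
    by (rule has_vector_derivative_transform[OF Suc.prems, rotated]) (use Suc.IH in auto)
  thus ?case using vector_derivative_within_closed_interval[OF assms(2) Suc.prems] by simp
qed simp

text \<open>
The integrand of the principal value after adding the contributions of t and -t.
\<close>

definition fold_kernel :: "(real \<Rightarrow> real) \<Rightarrow> real \<Rightarrow> real \<Rightarrow> complex" where
  "fold_kernel \<psi> x t = (cis (x * \<psi> t) - cis (x * \<psi> (- t))) / of_real t"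

lemma continuous_on_fold_kernel:
  assumes "continuous_on {-1..1} \<psi>" "0 < a" "b \<le> 1"
  shows "continuous_on {a..b} (fold_kernel \<psi> x)"
proof -
  have "continuous_on {a..b} \<psi>" by (rule continuous_on_subset[OF assms(1)]) (use assms in auto)
  moreover have "continuous_on {a..b} (\<lambda>t. \<psi> (- t))"
    by (rule continuous_on_compose2[OF assms(1)]) (use assms in \<open>auto intro!: continuous_intros\<close>)
  ultimately show ?thesis unfolding fold_kernel_def using assms by (auto intro!: continuous_intros)
qed

lemma integral_annulus_eq_fold_kernel:
  assumes \<psi>: "continuous_on {-1..1} \<psi>" and \<epsilon>: "0 < \<epsilon>" "\<epsilon> < 1"
  shows "integral {t. \<epsilon> \<le> \<bar>t\<bar> \<and> \<bar>t\<bar> \<le> 1} (\<lambda>t. exp (\<i> * of_real (x * \<psi> t)) / of_real t)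
       = integral {\<epsilon>..1} (fold_kernel \<psi> x)"
proof -
  define F where "F t = cis (x * \<psi> t) / of_real t" for t
  have cont: "continuous_on A F" if "A \<subseteq> {-1..1}" "0 \<notin> A" for A
  proof -
    have "continuous_on A \<psi>" by (rule continuous_on_subset[OF \<psi> that(1)])
    thus ?thesis unfolding F_def using that by (auto intro!: continuous_intros)
  qed
  have iR: "F integrable_on {\<epsilon>..1}" "F integrable_on {-1..-\<epsilon>}"
    using \<epsilon> by (auto intro!: integrable_continuous_interval cont)
  have iL: "(\<lambda>t. F (- t)) integrable_on {\<epsilon>..1}"
    using iR(2) Henstock_Kurzweil_Integration.integrable_reflect_real[where f = F and a = "-1" and b = "-\<epsilon>"] by simp
  have "{t. \<epsilon> \<le> \<bar>t\<bar> \<and> \<bar>t\<bar> \<le> 1} = {-1..-\<epsilon>} \<union> {\<epsilon>..1}" using \<epsilon> by auto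
  hence "integral {t. \<epsilon> \<le> \<bar>t\<bar> \<and> \<bar>t\<bar> \<le> 1} F = integral {-1..-\<epsilon>} F + integral {\<epsilon>..1} F"
    using iR \<epsilon> by (simp add: integral_Un)
  also have "integral {-1..-\<epsilon>} F = integral {\<epsilon>..1} (\<lambda>t. F (- t))"
    using Henstock_Kurzweil_Integration.integral_reflect_real[where f = "\<lambda>t. F (- t)" and a = \<epsilon> and b = 1] by simp
  also have "\<dots> + integral {\<epsilon>..1} F = integral {\<epsilon>..1} (\<lambda>t. F (- t) + F t)"
    using iL iR by (simp add: integral_add)
  also have "\<dots> = integral {\<epsilon>..1} (fold_kernel \<psi> x)"
    by (rule integral_cong) (simp add: F_def fold_kernel_def diff_divide_distrib)
  finally show ?thesis by (simp add: F_def[abs_def] cis_conv_exp)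
qed

text \<open>
The folded kernel has the finite limit 2 i x \<psi>'(0) cis (x \<psi>(0)) at 0.  With this value at 0 it
is continuous on the closed interval, so the principal value exists as an ordinary integral.
\<close>

lemma stein_wainger_tendsto:
  assumes "smooth_on {-1..1} \<psi>"
  shows "((\<lambda>\<epsilon>. integral {\<epsilon>..1} (fold_kernel \<psi> x)) \<longlongrightarrow> stein_wainger \<psi> x) (at_right 0)"
proof -
  define d where "d = deriv_within {-1..1} 1 \<psi> 0"
  have \<psi>: "continuous_on {-1..1} \<psi>" using smooth_on_continuous[OF assms, of 0] by simp
  have d: "(\<psi> has_real_derivative d) (at 0)"
    using smooth_on_DERIV[OF assms, of 0 0] by (simp add: d_def)
  define G where "G t = cis (x * \<psi> t) - cis (x * \<psi> (- t))" for t
  define L where "L = 2 * \<i> * of_real (x * d) * cis (x * \<psi> 0)"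
  have d1: "((\<lambda>t. x * \<psi> t) has_real_derivative x * d) (at 0)"
    using d by (auto intro!: derivative_eq_intros)
  have d2: "((\<lambda>t. x * \<psi> (- t)) has_real_derivative - (x * d)) (at 0)"
    using DERIV_mirror[of \<psi> d 0] d by (auto intro!: derivative_eq_intros)
  have e: "((\<lambda>t. cis (p t)) has_vector_derivative (\<i> * of_real p' * cis (p 0))) (at 0)"
    if "(p has_real_derivative p') (at 0)" for p p'
    using has_derivative_cis[of p "\<lambda>h. p' * h" 0 UNIV] that
    by (simp add: has_vector_derivative_def has_field_derivative_def scaleR_conv_of_real mult_ac
        mult_commute_abs)
  have "(G has_vector_derivative (\<i> * of_real (x * d) * cis (x * \<psi> 0) - \<i> * of_real (- (x * d)) * cis (x * \<psi> (- 0)))) (at 0)"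
    unfolding G_def[abs_def] by (intro has_vector_derivative_diff e d1 d2)
  hence "(G has_derivative (\<lambda>h. h *\<^sub>R L)) (at 0)"
    by (simp add: L_def algebra_simps has_vector_derivative_def)
  hence *: "((\<lambda>t. norm (G t - t *\<^sub>R L) / norm t) \<longlongrightarrow> 0) (at 0)"
    by (simp add: has_derivative_iff_norm G_def)
  define h where "h t = (if t = 0 then L else fold_kernel \<psi> x t)" for t
  have "((\<lambda>t. norm (h t - L)) \<longlongrightarrow> 0) (at 0)"
  proof (rule Lim_transform_eventually[OF *])
    show "\<forall>\<^sub>F t in at 0. norm (G t - t *\<^sub>R L) / norm t = norm (h t - L)"
      unfolding eventually_at_filter
    proof (intro always_eventually allI impI)
      fix t :: real assume t: "t \<noteq> 0"
      have "norm (h t - L) = norm ((G t - t *\<^sub>R L) / of_real t)"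
        using t by (simp add: h_def G_def fold_kernel_def diff_divide_distrib scaleR_conv_of_real)
      thus "norm (G t - t *\<^sub>R L) / norm t = norm (h t - L)"
        by (simp add: norm_divide)
    qed
  qed
  hence "(h \<longlongrightarrow> L) (at 0)"
    by (simp add: Lim_null[of h] tendsto_norm_zero_iff)
  hence h0: "continuous (at 0 within {0..1}) h"
    using tendsto_mono[OF at_le[OF subset_UNIV], of h L] by (simp add: continuous_within h_def)
  have ht: "continuous (at t within {0..1}) h" if "t \<in> {0<..1}" for t
  proof -
    have "continuous_on {t/2..1} (fold_kernel \<psi> x)"
      using continuous_on_fold_kernel[OF \<psi>, of "t/2" 1] that by simp
    hence "continuous_on {t/2..1} h"
      using that by (subst continuous_on_cong[of _ _ _ "fold_kernel \<psi> x"]) (auto simp: h_def)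
    moreover have "t \<in> {t/2..1}" using that by simp
    ultimately have "continuous (at t within {t/2..1}) h" by (simp add: continuous_on_eq_continuous_within)
    moreover have "at t within {0..1} = at t within {t/2..1}"
      by (rule at_within_nhd[of _ "{t/2<..<2}"]) (use that in auto)
    ultimately show ?thesis by simp
  qed
  have hc: "continuous_on {0..1} h"
    unfolding continuous_on_eq_continuous_within
  proof
    fix t :: real assume "t \<in> {0..1}"
    thus "continuous (at t within {0..1}) h" using h0 ht[of t] by (cases "t = 0") auto
  qed
  have "continuous_on {0..1} (\<lambda>\<epsilon>. integral {\<epsilon>..1} h)"
    by (intro indefinite_integral_continuous_1' integrable_continuous_interval hc)
  hence "((\<lambda>\<epsilon>. integral {\<epsilon>..1} h) \<longlongrightarrow> integral {0..1} h) (at 0 within {0..1})"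
    by (simp add: continuous_on_def)
  moreover have "at 0 within {0..1::real} = at_right 0"
    by (rule at_within_nhd[of _ "{-1<..<1}"]) auto
  ultimately have "((\<lambda>\<epsilon>. integral {\<epsilon>..1} h) \<longlongrightarrow> integral {0..1} h) (at_right 0)" by simp
  hence lim: "((\<lambda>\<epsilon>. integral {\<epsilon>..1} (fold_kernel \<psi> x)) \<longlongrightarrow> integral {0..1} h) (at_right 0)"
  proof (rule Lim_transform_eventually)
    show "\<forall>\<^sub>F \<epsilon> in at_right 0. integral {\<epsilon>..1} h = integral {\<epsilon>..1} (fold_kernel \<psi> x)"
      unfolding eventually_at_filter
      by (intro always_eventually allI impI integral_cong) (auto simp: h_def)
  qed
  hence "((\<lambda>\<epsilon>. integral {t. \<epsilon> \<le> \<bar>t\<bar> \<and> \<bar>t\<bar> \<le> 1} (\<lambda>t. exp (\<i> * of_real (x * \<psi> t)) / of_real t))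
     \<longlongrightarrow> integral {0..1} h) (at_right 0)"
  proof (rule Lim_transform_eventually)
    show "\<forall>\<^sub>F \<epsilon> in at_right 0. integral {\<epsilon>..1} (fold_kernel \<psi> x)
        = integral {t. \<epsilon> \<le> \<bar>t\<bar> \<and> \<bar>t\<bar> \<le> 1} (\<lambda>t. exp (\<i> * of_real (x * \<psi> t)) / of_real t)"
      using eventually_at_right_real[OF zero_less_one]
      by eventually_elim (use integral_annulus_eq_fold_kernel[OF \<psi>] in auto)
  qed
  hence "stein_wainger \<psi> x = integral {0..1} h"
    unfolding stein_wainger_def by (intro tendsto_Lim) auto
  thus ?thesis using lim by simp
qed

text \<open>
All upper bounds below are proved for the truncated integrals and pass to the limit through this lemma.
\<close>

lemma stein_wainger_bound:
  assumes "smooth_on {-1..1} \<psi>" "0 < \<epsilon>0"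
    "\<And>\<epsilon>. 0 < \<epsilon> \<Longrightarrow> \<epsilon> < \<epsilon>0 \<Longrightarrow> cmod (integral {\<epsilon>..1} (fold_kernel \<psi> x)) \<le> B"
  shows "cmod (stein_wainger \<psi> x) \<le> B"
proof (rule tendsto_upperbound[OF tendsto_norm[OF stein_wainger_tendsto[OF assms(1)]]])
  show "\<forall>\<^sub>F \<epsilon> in at_right 0. cmod (integral {\<epsilon>..1} (fold_kernel \<psi> x)) \<le> B"
    using eventually_at_right_real[OF assms(2)] by eventually_elim (use assms(3) in auto)
qed simp

lemma fold_kernel_integral_log_bound:
  assumes "continuous_on {-1..1} \<psi>" "0 < a" "a \<le> b" "b \<le> 1"
  shows "cmod (integral {a..b} (fold_kernel \<psi> x)) \<le> 2 * ln (b / a)"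
proof -
  have *: "((\<lambda>t. 2 / t) has_integral (2 * ln b - 2 * ln a)) {a..b}"
    using assms by (intro fundamental_theorem_of_calculus)
      (auto intro!: derivative_eq_intros simp flip: has_real_derivative_iff_has_vector_derivative)
  have "cmod (integral {a..b} (fold_kernel \<psi> x)) \<le> integral {a..b} (\<lambda>t. 2 / t)"
  proof (rule integral_norm_bound_integral)
    show "fold_kernel \<psi> x integrable_on {a..b}"
      by (intro integrable_continuous_interval continuous_on_fold_kernel assms)
    show "(\<lambda>t. 2 / t) integrable_on {a..b}" using * by blast
    fix t assume "t \<in> {a..b}"
    moreover have "cmod (cis (x * \<psi> t) - cis (x * \<psi> (- t))) \<le> 2"
      by (rule order.trans[OF norm_triangle_ineq4]) simp
    ultimately show "cmod (fold_kernel \<psi> x t) \<le> 2 / t"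
      using assms by (simp add: fold_kernel_def norm_divide divide_right_mono)
  qed
  also have "\<dots> = 2 * ln (b / a)" using * assms by (simp add: integral_unique ln_div)
  finally show ?thesis .
qed

lemma cmod_cis_diff_le: "cmod (cis a - cis b) \<le> \<bar>a - b\<bar>"
proof -
  have "cmod (cis a - cis b) = cmod (cis b * (cis (a - b) - 1))"
    by (simp add: algebra_simps cis_mult)
  also have "\<dots> = cmod (cis (a - b) - 1)" by (simp add: norm_mult)
  also have "\<dots> \<le> \<bar>a - b\<bar>"
    using dist_exp_i_1[of "a - b"] abs_sin_x_le_abs_x[of "(a - b) / 2"] by (simp add: cis_conv_exp)
  finally show ?thesis .
qed

lemma fold_kernel_integral_small_bound:
  assumes "continuous_on {-1..1} \<psi>" "0 < a" "a \<le> b" "b \<le> 1" "D \<ge> 0"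
    and D: "\<And>t. 0 < t \<Longrightarrow> t \<le> b \<Longrightarrow> \<bar>\<psi> t - \<psi> (- t)\<bar> \<le> D * t"
  shows "cmod (integral {a..b} (fold_kernel \<psi> x)) \<le> \<bar>x\<bar> * D * b"
proof -
  have "cmod (integral {a..b} (fold_kernel \<psi> x)) \<le> integral {a..b} (\<lambda>t. \<bar>x\<bar> * D)"
  proof (rule integral_norm_bound_integral)
    show "fold_kernel \<psi> x integrable_on {a..b}"
      by (intro integrable_continuous_interval continuous_on_fold_kernel assms)
    fix t assume t: "t \<in> {a..b}"
    have "cmod (cis (x * \<psi> t) - cis (x * \<psi> (- t))) \<le> \<bar>x * \<psi> t - x * \<psi> (- t)\<bar>"
      by (rule cmod_cis_diff_le)
    also have "\<dots> = \<bar>x\<bar> * \<bar>\<psi> t - \<psi> (- t)\<bar>" by (simp add: abs_mult flip: right_diff_distrib)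
    also have "\<dots> \<le> \<bar>x\<bar> * (D * t)" using D[of t] t assms by (intro mult_left_mono) auto
    finally show "cmod (fold_kernel \<psi> x t) \<le> \<bar>x\<bar> * D"
      using t assms by (simp add: fold_kernel_def norm_divide field_simps)
  qed auto
  also have "\<dots> = \<bar>x\<bar> * D * (b - a)" using assms by simp
  also have "\<dots> \<le> \<bar>x\<bar> * D * b" using assms by (intro mult_left_mono) auto
  finally show ?thesis .
qed

section \<open>Phases whose odd part has finite order at the origin\<close>

text \<open>
Integration by parts: cis (x p) / t is, up to the factor i x, the derivative of cis (x p) / (t p') minus a
term with the derivative of 1/(t p').  The hypotheses on p' and p'' bound the boundary terms by a
multiple of a^(-r) and the new integrand by a multiple of t^(-r-1).
\<close>

lemma oscillatory_integral_bound:
  fixes p p1 p2 :: "real \<Rightarrow> real"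
  assumes a: "0 < a" "a \<le> b" and r: "r \<ge> 1" and c: "c > 0" and x: "x > 0"
    and d1: "\<And>t. t \<in> {a..b} \<Longrightarrow> (p has_real_derivative p1 t) (at t)"
    and d2: "\<And>t. t \<in> {a..b} \<Longrightarrow> (p1 has_real_derivative p2 t) (at t)"
    and cont: "continuous_on {a..b} p2"
    and low: "\<And>t. t \<in> {a..b} \<Longrightarrow> c * t ^ (r - 1) \<le> \<bar>p1 t\<bar>"
    and up: "\<And>t. t \<in> {a..b} \<Longrightarrow> t * \<bar>p2 t\<bar> \<le> C * t ^ (r - 1)"
  shows "cmod (integral {a..b} (\<lambda>t. cis (x * p t) / of_real t)) \<le> (3 / c + C / c\<^sup>2) / (x * a ^ r)"
proof -
  have t0: "t > 0" if "t \<in> {a..b}" for t using that a by auto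
  have p1: "p1 t \<noteq> 0" if "t \<in> {a..b}" for t
    using low[OF that] mult_pos_pos[OF c zero_less_power[OF t0[OF that], of "r - 1"]] by auto
  have C: "0 \<le> C"
  proof -
    have "0 \<le> C * a ^ (r - 1)" using up[of a] a by (smt (verit) atLeastAtMost_iff mult_nonneg_nonneg)
    thus ?thesis by (metis a(1) linorder_not_le mult_neg_pos zero_less_power)
  qed
  have tr: "t ^ r = t * t ^ (r - 1)" for t :: real using r by (cases r) auto
  define v where "v t = 1 / (t * p1 t)" for t
  define v' where "v' t = - ((p1 t + t * p2 t) / (t * p1 t)\<^sup>2)" for t
  have dv: "(v has_real_derivative v' t) (at t)" if "t \<in> {a..b}" for t
    unfolding v_def[abs_def] v'_def using t0[OF that] p1[OF that]
    by (auto intro!: derivative_eq_intros d2[OF that] simp: power2_eq_square field_simps)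
  define W where "W t = cis (x * p t) * of_real (v t)" for t
  have dW: "(W has_vector_derivative (\<i> * of_real x * (cis (x * p t) / of_real t) + cis (x * p t) * of_real (v' t))) (at t within {a..b})"
    if t: "t \<in> {a..b}" for t
  proof -
    have "((\<lambda>t. x * p t) has_real_derivative x * p1 t) (at t)"
      by (auto intro!: derivative_eq_intros d1[OF t])
    hence "((\<lambda>t. cis (x * p t)) has_vector_derivative of_real (x * p1 t) * (\<i> * cis (x * p t))) (at t)"
      using has_derivative_cis[of "\<lambda>t. x * p t" "\<lambda>h. x * p1 t * h" t UNIV]
      by (simp add: has_vector_derivative_def has_field_derivative_def scaleR_conv_of_real mult_ac mult_commute_abs)
    moreover have "((\<lambda>t. complex_of_real (v t)) has_vector_derivative of_real (v' t)) (at t)"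
      using dv[OF t] by (simp add: has_vector_derivative_of_real has_real_derivative_iff_has_vector_derivative)
    ultimately have "(W has_vector_derivative (cis (x * p t) * of_real (v' t) + of_real (x * p1 t) * (\<i> * cis (x * p t)) * of_real (v t))) (at t)"
      unfolding W_def[abs_def] by (rule has_vector_derivative_mult)
    moreover have "of_real (x * p1 t) * (\<i> * cis (x * p t)) * of_real (v t) = \<i> * of_real x * (cis (x * p t) / of_real t)"
      using p1[OF t] t0[OF t] by (simp add: v_def)
    ultimately show ?thesis by (simp add: has_vector_derivative_at_within add.commute)
  qed
  have cp: "continuous_on {a..b} p" "continuous_on {a..b} p1"
    using d1 d2 by (meson DERIV_isCont continuous_at_imp_continuous_on)+
  have iI: "(\<lambda>t. cis (x * p t) / of_real t) integrable_on {a..b}"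
    using t0 by (intro integrable_continuous_interval continuous_intros cp) fastforce
  have "continuous_on {a..b} v'" unfolding v'_def[abs_def]
    using t0 p1 by (intro continuous_intros cp cont) fastforce
  hence iV: "(\<lambda>t. cis (x * p t) * of_real (v' t)) integrable_on {a..b}"
    by (intro integrable_continuous_interval continuous_intros cp)
  have "integral {a..b} (\<lambda>t. \<i> * of_real x * (cis (x * p t) / of_real t) + cis (x * p t) * of_real (v' t)) = W b - W a"
    using fundamental_theorem_of_calculus[OF a(2) dW] by (rule integral_unique)
  hence eq: "\<i> * of_real x * integral {a..b} (\<lambda>t. cis (x * p t) / of_real t) = 
      W b - W a - integral {a..b} (\<lambda>t. cis (x * p t) * of_real (v' t))"
    using iI iV integral_mult_right[of "{a..b}" "\<i> * of_real x" "\<lambda>t. cis (x * p t) / of_real t"]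
      integrable_on_mult_right[OF iI, of "\<i> * of_real x"]
    by (subst (asm) integral_add) (simp_all only: eq_diff_eq)
  have W: "cmod (W t) \<le> 1 / (c * a ^ r)" if t: "t \<in> {a..b}" for t
  proof -
    have "c * a ^ r \<le> c * t ^ r" using c a t by (intro mult_left_mono power_mono) auto
    also have "\<dots> \<le> t * \<bar>p1 t\<bar>" using mult_left_mono[OF low[OF t], of t] t0[OF t] by (simp add: tr mult_ac)
    finally have "1 / (t * \<bar>p1 t\<bar>) \<le> 1 / (c * a ^ r)" using a c t0[OF t] p1[OF t] by (intro divide_left_mono mult_pos_pos) auto
    thus ?thesis using t0[OF t] by (simp add: W_def v_def norm_mult norm_divide abs_mult)
  qed
  define D where "D = 1 / c + C / c\<^sup>2"
  have D: "D \<ge> 0" using c C by (simp add: D_def)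
  have V: "cmod (cis (x * p t) * of_real (v' t)) \<le> D / t ^ (r + 1)" if t: "t \<in> {a..b}" for t
  proof -
    define q where "q = \<bar>p1 t\<bar>"
    have q: "q > 0" "c * t ^ (r - 1) \<le> q" using p1[OF t] low[OF t] by (auto simp: q_def)
    have tt: "t > 0" "t ^ (r - 1) > 0" using t0[OF t] by auto
    have "cmod (cis (x * p t) * of_real (v' t)) = \<bar>v' t\<bar>" by (simp add: norm_mult)
    also have "\<dots> = \<bar>p1 t + t * p2 t\<bar> / (t * q)\<^sup>2"
      by (simp add: v'_def q_def power_mult_distrib)
    also have "\<dots> \<le> (q + C * t ^ (r - 1)) / (t * q)\<^sup>2"
      using up[OF t] t0[OF t] by (intro divide_right_mono order.trans[OF abs_triangle_ineq]) (auto simp: q_def abs_mult)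
    also have "\<dots> = 1 / (t\<^sup>2 * q) + C * t ^ (r - 1) / (t\<^sup>2 * q\<^sup>2)"
      using q tt by (simp add: field_simps power2_eq_square)
    also have "\<dots> \<le> 1 / (t\<^sup>2 * (c * t ^ (r - 1))) + C * t ^ (r - 1) / (t\<^sup>2 * (c * t ^ (r - 1))\<^sup>2)"
      using q tt c C by (intro add_mono divide_left_mono mult_left_mono power_mono mult_pos_pos) auto
    also have "\<dots> = D / (t * (t * t ^ (r - 1)))"
      using tt c by (simp add: D_def field_simps power2_eq_square)
    finally show ?thesis by (simp add: tr[of t])
  qed
  have ad: "((\<lambda>t. D / t ^ (r + 1)) has_integral (- (D / (real r * b ^ r)) - - (D / (real r * a ^ r)))) {a..b}"
  proof (rule fundamental_theorem_of_calculus[OF a(2)])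
    fix t assume t: "t \<in> {a..b}"
    have "((\<lambda>t. - (D / (real r * t ^ r))) has_real_derivative D / t ^ (r + 1)) (at t within {a..b})"
    proof -
      define u where "u t = t ^ r" for t :: real
      have u: "(u has_real_derivative real r * t ^ (r - 1)) (at t within {a..b})"
        unfolding u_def[abs_def] by (auto intro!: derivative_eq_intros)
      have "((\<lambda>t. - (D / (real r * u t))) has_real_derivative D / t ^ (r + 1)) (at t within {a..b})"
        using t0[OF t] r
        by (auto intro!: derivative_eq_intros u simp: u_def tr[of t] field_simps power2_eq_square)
      thus ?thesis by (simp add: u_def)
    qed
    thus "((\<lambda>t. - (D / (real r * t ^ r))) has_vector_derivative D / t ^ (r + 1)) (at t within {a..b})"
      by (simp add: has_real_derivative_iff_has_vector_derivative)
  qed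
  have "cmod (integral {a..b} (\<lambda>t. cis (x * p t) * of_real (v' t))) \<le> integral {a..b} (\<lambda>t. D / t ^ (r + 1))"
    using iV ad V by (intro integral_norm_bound_integral) auto
  also have "\<dots> \<le> D / (real r * a ^ r)" using integral_unique[OF ad] D a by simp
  also have "\<dots> \<le> D / (1 * a ^ r)" using r a D by (intro divide_left_mono mult_right_mono mult_pos_pos) auto
  finally have I2: "cmod (integral {a..b} (\<lambda>t. cis (x * p t) * of_real (v' t))) \<le> D / a ^ r" by simp
  have "x * cmod (integral {a..b} (\<lambda>t. cis (x * p t) / of_real t)) = 
      cmod (\<i> * of_real x * integral {a..b} (\<lambda>t. cis (x * p t) / of_real t))"
    using x by (simp add: norm_mult)
  also have "\<dots> \<le> cmod (W b) + cmod (W a) + cmod (integral {a..b} (\<lambda>t. cis (x * p t) * of_real (v' t)))"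
    unfolding eq by (meson add_right_mono norm_triangle_ineq4 order.trans)
  also have "\<dots> \<le> 1 / (c * a ^ r) + 1 / (c * a ^ r) + D / a ^ r"
    using a by (intro add_mono W I2) auto
  also have "\<dots> = (3 / c + C / c\<^sup>2) / a ^ r" using a c by (simp add: D_def field_simps)
  finally show ?thesis using x a by (simp add: field_simps)
qed

text \<open>
If r is the order of the first nonvanishing derivative at 0, Taylor's formula for f' and f'' provides the
two-sided hypotheses of the previous lemma near 0.
\<close>

lemma finite_type_oscillation:
  fixes f :: "nat \<Rightarrow> real \<Rightarrow> real"
  assumes deriv: "\<And>n t. \<bar>t\<bar> < 1 \<Longrightarrow> (f n has_real_derivative f (Suc n) t) (at t)"
    and r: "r \<ge> 1" "f r 0 \<noteq> 0" "\<And>j. 1 \<le> j \<Longrightarrow> j < r \<Longrightarrow> f j 0 = 0"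
  obtains \<delta> C where "0 < \<delta>" "\<delta> < 1"
    "\<And>a b x. 0 < a \<Longrightarrow> a \<le> b \<Longrightarrow> b \<le> \<delta> \<Longrightarrow> x > 0 \<Longrightarrow>
       cmod (integral {a..b} (\<lambda>t. cis (x * f 0 t) / of_real t)) \<le> C / (x * a ^ r)"
proof -
  have cont: "continuous_on {0..1/2} (f n)" for n
    using DERIV_isCont[OF deriv] by (intro continuous_at_imp_continuous_on ballI) auto
  have "isCont (\<lambda>t. \<bar>f r t\<bar>) 0" using DERIV_isCont[OF deriv[of 0 r]] by (intro continuous_intros) auto
  hence "\<forall>\<^sub>F t in at 0. \<bar>f r 0\<bar> / 2 < \<bar>f r t\<bar>"
    unfolding isCont_def by (rule order_tendstoD) (use r in auto)
  then obtain e where e: "e > 0" "\<And>t. t \<noteq> 0 \<Longrightarrow> \<bar>t\<bar> < e \<Longrightarrow> \<bar>f r 0\<bar> / 2 < \<bar>f r t\<bar>"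
    unfolding eventually_at by (auto simp: dist_real_def)
  define \<delta> where "\<delta> = min (e/2) (1/2)"
  \<comment> \<open>For r = 1 the truncated difference is 0, and boundedness of f 2 near 0 suffices.\<close>
  define n where "n = r - 2"
  have "bounded (f (2 + n) ` {0..1/2})"
    by (intro compact_imp_bounded compact_continuous_image cont) auto
  then obtain B where "\<forall>y\<in>f (2 + n) ` {0..1/2}. norm y \<le> B" unfolding bounded_iff by blast
  hence B: "\<bar>f (2 + n) t\<bar> \<le> B" if "t \<in> {0..1/2}" for t
    using that by (metis imageI real_norm_def)
  define c where "c = \<bar>f r 0\<bar> / 2 / fact (r - 1)"
  have c: "c > 0" using r by (simp add: c_def)
  show ?thesis
  proof (rule that)
    show "0 < \<delta>" "\<delta> < 1" using e by (auto simp: \<delta>_def)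
    fix a b x :: real assume ab: "0 < a" "a \<le> b" "b \<le> \<delta>" "x > 0"
    have t: "0 < t" "t \<le> 1/2" "t < e" if "t \<in> {a..b}" for t
      using that ab e(1) by (auto simp: \<delta>_def)
    show "cmod (integral {a..b} (\<lambda>t. cis (x * f 0 t) / of_real t)) \<le> (3 / c + B / c\<^sup>2) / (x * a ^ r)"
    proof (rule oscillatory_integral_bound[where ?p1.0 = "f 1" and ?p2.0 = "f 2"])
      show "continuous_on {a..b} (f 2)"
        by (rule continuous_on_subset[OF cont]) (use t ab in auto)
    next
      fix t assume t': "t \<in> {a..b}"
      show "(f 0 has_real_derivative f 1 t) (at t)" "(f 1 has_real_derivative f 2 t) (at t)"
        using deriv[of t 0] deriv[of t 1] t[OF t'] by (auto simp: numeral_2_eq_2)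
      obtain z where z: "0 < z" "z \<le> t" "f (1 + 0) t = f (1 + (r - 1)) z / fact (r - 1) * t ^ (r - 1)"
        by (rule taylor_flat[of t "\<lambda>m. f (1 + m)" "r - 1"]) (use t[OF t'] deriv r in auto)
      have "\<bar>f r 0\<bar> / 2 \<le> \<bar>f r z\<bar>" using e(2)[of z] z t[OF t'] by simp
      hence "c * t ^ (r - 1) \<le> \<bar>f r z\<bar> / fact (r - 1) * t ^ (r - 1)"
        unfolding c_def using t[OF t'] by (intro mult_right_mono divide_right_mono) auto
      also have "\<dots> = \<bar>f 1 t\<bar>" using z r t[OF t'] by (simp add: abs_mult)
      finally show "c * t ^ (r - 1) \<le> \<bar>f 1 t\<bar>" .
      obtain z where z: "0 < z" "z \<le> t" "f (2 + 0) t = f (2 + n) z / fact n * t ^ n"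
        by (rule taylor_flat[of t "\<lambda>m. f (2 + m)" "n"]) (use t[OF t'] deriv r in \<open>auto simp: n_def\<close>)
      have B0: "0 \<le> B" using B[of 0] by simp
      have "\<bar>f 2 t\<bar> = \<bar>f (2 + n) z\<bar> / fact n * t ^ n" using z t[OF t'] by (simp add: abs_mult)
      also have "\<dots> \<le> B / 1 * t ^ n"
        using B[of z] z t[OF t'] B0 by (intro mult_right_mono frac_le) (auto simp: fact_ge_1)
      finally have "t * \<bar>f 2 t\<bar> \<le> B * (t * t ^ n)" using t[OF t'] by (simp add: mult_left_mono mult.left_commute)
      also have "t * t ^ n = t ^ (Suc n)" by simp
      also have "B * t ^ (Suc n) \<le> B * t ^ (r - 1)"
        using t[OF t'] B0 by (intro mult_left_mono power_decreasing) (auto simp: n_def)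
      finally show "t * \<bar>f 2 t\<bar> \<le> B * t ^ (r - 1)" .
    qed (use ab r c in auto)
  qed
qed

text \<open>
The odd order m controls where the trivial estimate stops working, the full order r \<le> m controls the
oscillation.  At the scale a with x a^m = 1 both estimates are O(1).
\<close>

lemma stein_wainger_bounded_nonflat:
  assumes \<psi>: "smooth_on {-1..1} \<psi>" and odd: "odd n" "deriv_within {-1..1} n \<psi> 0 \<noteq> 0"
  obtains B where "\<forall>\<^sub>F x in at_top. cmod (stein_wainger \<psi> x) \<le> B"
proof -
  define g where "g n = deriv_within {-1..1} n \<psi>" for n
  have g: "(g n has_real_derivative g (Suc n) t) (at t)" if "\<bar>t\<bar> < 1" for n t
    unfolding g_def by (rule smooth_on_DERIV[OF \<psi> that])
  have g': "((\<lambda>t. (-1) ^ n * g n (- t)) has_real_derivative (-1) ^ Suc n * g (Suc n) (- t)) (at t)"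
    if "\<bar>t\<bar> < 1" for n t
  proof -
    have "((\<lambda>t. g n (- t)) has_real_derivative - g (Suc n) (- t)) (at t)"
      using g[of "- t" n] that by (simp add: DERIV_mirror)
    from DERIV_cmult[OF this, of "(-1) ^ n"] show ?thesis by simp
  qed
  have g0: "g 0 = \<psi>" by (simp add: g_def)
  have cont: "continuous_on {-1..1} \<psi>" using smooth_on_continuous[OF \<psi>, of 0] by simp
  define m where "m = (LEAST n. odd n \<and> g n 0 \<noteq> 0)"
  have m: "odd m" "g m 0 \<noteq> 0"
    using LeastI[of "\<lambda>n. odd n \<and> g n 0 \<noteq> 0" n] odd by (auto simp: m_def g_def)
  have m_min: "g j 0 = 0" if "odd j" "j < m" for j
    using not_less_Least[of j "\<lambda>n. odd n \<and> g n 0 \<noteq> 0"] that by (auto simp: m_def)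
  have m1: "m \<ge> 1" using m(1) by (cases m) auto
  define r where "r = (LEAST n. 1 \<le> n \<and> g n 0 \<noteq> 0)"
  have r: "r \<ge> 1" "g r 0 \<noteq> 0"
    using LeastI[of "\<lambda>n. 1 \<le> n \<and> g n 0 \<noteq> 0" m] m m1 by (auto simp: r_def)
  have r_min: "g j 0 = 0" if "1 \<le> j" "j < r" for j
    using not_less_Least[of j "\<lambda>n. 1 \<le> n \<and> g n 0 \<noteq> 0"] that by (auto simp: r_def)
  have rm: "r \<le> m" unfolding r_def using m m1 by (intro Least_le) auto
  obtain \<delta>1 C1 where 1: "0 < \<delta>1" "\<delta>1 < 1"
    "\<And>a b x. 0 < a \<Longrightarrow> a \<le> b \<Longrightarrow> b \<le> \<delta>1 \<Longrightarrow> x > 0 \<Longrightarrow>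
       cmod (integral {a..b} (\<lambda>t. cis (x * \<psi> t) / of_real t)) \<le> C1 / (x * a ^ r)"
  proof (rule finite_type_oscillation[of g r])
    fix \<delta> C
    assume "0 < \<delta>" "\<delta> < 1" "\<And>a b x. 0 < a \<Longrightarrow> a \<le> b \<Longrightarrow> b \<le> \<delta> \<Longrightarrow> x > 0 \<Longrightarrow>
       cmod (integral {a..b} (\<lambda>t. cis (x * g 0 t) / of_real t)) \<le> C / (x * a ^ r)"
    thus thesis using that[of \<delta> C] by (simp add: g0)
  qed (use g r r_min in auto)
  obtain \<delta>2 C2 where 2: "0 < \<delta>2" "\<delta>2 < 1"
    "\<And>a b x. 0 < a \<Longrightarrow> a \<le> b \<Longrightarrow> b \<le> \<delta>2 \<Longrightarrow> x > 0 \<Longrightarrow>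
       cmod (integral {a..b} (\<lambda>t. cis (x * \<psi> (- t)) / of_real t)) \<le> C2 / (x * a ^ r)"
  proof (rule finite_type_oscillation[of "\<lambda>n t. (-1) ^ n * g n (- t)" r])
    fix \<delta> C
    assume "0 < \<delta>" "\<delta> < 1" "\<And>a b x. 0 < a \<Longrightarrow> a \<le> b \<Longrightarrow> b \<le> \<delta> \<Longrightarrow> x > 0 \<Longrightarrow>
       cmod (integral {a..b} (\<lambda>t. cis (x * ((-1) ^ 0 * g 0 (- t))) / of_real t)) \<le> C / (x * a ^ r)"
    thus thesis using that[of \<delta> C] by (simp add: g0)
  qed (use g' r r_min in auto)
  define \<delta> where "\<delta> = min (min \<delta>1 \<delta>2) (1/2)"
  have \<delta>: "0 < \<delta>" "\<delta> \<le> \<delta>1" "\<delta> \<le> \<delta>2" "\<delta> \<le> 1/2" "\<delta> < 1" using 1 2 by (auto simp: \<delta>_def)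
  \<comment> \<open>The derivatives of twice the odd part of \<psi>.\<close>
  define h where "h n t = g n t - (-1) ^ n * g n (- t)" for n t
  have h: "(h n has_real_derivative h (Suc n) t) (at t)" if "\<bar>t\<bar> < 1" for n t
    unfolding h_def[abs_def] using g[OF that] g'[OF that] by (rule DERIV_diff)
  have h0: "h j 0 = 0" if "j < m" for j using m_min[OF _ that] by (cases "odd j") (auto simp: h_def)
  have "continuous_on {0..1/2} (h m)"
    using DERIV_isCont[OF h] by (intro continuous_at_imp_continuous_on ballI) auto
  hence "bounded (h m ` {0..1/2})" by (intro compact_imp_bounded compact_continuous_image) auto
  then obtain D where "\<forall>y\<in>h m ` {0..1/2}. norm y \<le> D" unfolding bounded_iff by blast
  hence D: "\<bar>h m t\<bar> \<le> D" if "t \<in> {0..1/2}" for t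
    using that by (metis imageI real_norm_def)
  have D0: "0 \<le> D" using D[of 0] by simp
  have hD: "\<bar>\<psi> t - \<psi> (- t)\<bar> \<le> D * t ^ m" if t: "0 < t" "t \<le> 1/2" for t
  proof -
    obtain z where z: "0 < z" "z \<le> t" "h 0 t = h m z / fact m * t ^ m"
      by (rule taylor_flat[of t h m]) (use t h h0 in auto)
    have "\<bar>h 0 t\<bar> = \<bar>h m z\<bar> / fact m * t ^ m" using z t by (simp add: abs_mult)
    also have "\<dots> \<le> D / 1 * t ^ m"
      using D[of z] z t D0 by (intro mult_right_mono frac_le) (auto simp: fact_ge_1)
    finally show ?thesis by (simp add: h_def g0)
  qed
  define B where "B = D + (\<bar>C1\<bar> + \<bar>C2\<bar>) + 2 * ln (1 / \<delta>)"
  have "\<forall>\<^sub>F x in at_top. cmod (stein_wainger \<psi> x) \<le> B"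
    using eventually_gt_at_top[of "max 1 (\<delta> powr - real m)"]
  proof eventually_elim
    case (elim x)
    \<comment> \<open>The scale at which the odd part of the phase x \<psi> reaches size one.\<close>
    define a where "a = x powr (- 1 / real m)"
    have a: "0 < a" using elim by (simp add: a_def)
    have am: "a ^ m = 1 / x"
    proof -
      have "a ^ m = a powr real m" using a by (simp add: powr_realpow)
      also have "\<dots> = x powr - 1" using m1 by (simp add: a_def powr_powr)
      finally show ?thesis using elim by (simp add: powr_minus_divide)
    qed
    have a\<delta>: "a \<le> \<delta>"
    proof (rule ccontr)
      assume "\<not> a \<le> \<delta>"
      hence "\<delta> ^ m < a ^ m" using \<delta> m1 by (intro power_strict_mono) auto
      moreover have "1 / x < \<delta> ^ m"
      proof -
        have "inverse (\<delta> ^ m) < x" using elim \<delta> by (simp add: powr_minus powr_realpow)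
        thus ?thesis using elim \<delta> by (simp add: field_simps)
      qed
      ultimately show False using am by simp
    qed
    have xar: "1 \<le> x * a ^ r"
    proof -
      have "a ^ m \<le> a ^ r" using a a\<delta> \<delta> rm by (intro power_decreasing) auto
      thus ?thesis using am elim by (simp add: field_simps)
    qed
    show ?case
    proof (rule stein_wainger_bound[OF \<psi> a])
      fix \<epsilon> assume \<epsilon>: "0 < \<epsilon>" "\<epsilon> < a"
      define K where "K = fold_kernel \<psi> x"
      have iK: "K integrable_on {u..v}" if "0 < u" "v \<le> 1" for u v
        unfolding K_def using that cont by (intro integrable_continuous_interval continuous_on_fold_kernel)
      have s1: "cmod (integral {\<epsilon>..a} K) \<le> D"
      proof -
        have "cmod (integral {\<epsilon>..a} K) \<le> \<bar>x\<bar> * (D * a ^ (m - 1)) * a"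
          unfolding K_def
        proof (rule fold_kernel_integral_small_bound[OF cont])
          fix t assume t: "0 < t" "t \<le> a"
          have "\<bar>\<psi> t - \<psi> (- t)\<bar> \<le> D * (t ^ (m - 1) * t)"
            using hD[of t] t a\<delta> \<delta> m1 by (simp flip: power_Suc2)
          also have "\<dots> \<le> D * (a ^ (m - 1) * t)"
            using t D0 by (intro mult_left_mono mult_right_mono power_mono) auto
          finally show "\<bar>\<psi> t - \<psi> (- t)\<bar> \<le> D * a ^ (m - 1) * t" by simp
        qed (use \<epsilon> a a\<delta> \<delta> D0 in auto)
        also have "\<dots> = D * (x * (a ^ (m - 1) * a))" using elim by simp
        also have "a ^ (m - 1) * a = a ^ m" using m1 by (simp flip: power_Suc2)
        finally show ?thesis using am elim by simp
      qed
      have s2: "cmod (integral {a..\<delta>} K) \<le> \<bar>C1\<bar> + \<bar>C2\<bar>"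
      proof -
        have c1: "continuous_on {a..\<delta>} \<psi>"
          by (rule continuous_on_subset[OF cont]) (use a \<delta> in auto)
        have c2: "continuous_on {a..\<delta>} (\<lambda>t. \<psi> (- t))"
          by (rule continuous_on_compose2[OF cont]) (use a \<delta> in \<open>auto intro!: continuous_intros\<close>)
        have "integral {a..\<delta>} K = integral {a..\<delta>} (\<lambda>t. cis (x * \<psi> t) / of_real t - cis (x * \<psi> (- t)) / of_real t)"
          by (rule integral_cong) (simp add: K_def fold_kernel_def diff_divide_distrib)
        also have "\<dots> = integral {a..\<delta>} (\<lambda>t. cis (x * \<psi> t) / of_real t) - integral {a..\<delta>} (\<lambda>t. cis (x * \<psi> (- t)) / of_real t)"
          using a by (intro integral_diff integrable_continuous_interval continuous_intros c1 c2) auto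
        also have "cmod \<dots> \<le> C1 / (x * a ^ r) + C2 / (x * a ^ r)"
          using a a\<delta> \<delta> elim by (intro order.trans[OF norm_triangle_ineq4] add_mono 1 2) auto
        also have "\<dots> \<le> \<bar>C1\<bar> / 1 + \<bar>C2\<bar> / 1"
          using xar by (intro add_mono frac_le) auto
        finally show ?thesis by simp
      qed
      have s3: "cmod (integral {\<delta>..1} K) \<le> 2 * ln (1 / \<delta>)"
        unfolding K_def using \<delta> by (intro fold_kernel_integral_log_bound cont) auto
      have "integral {\<epsilon>..1} K = integral {\<epsilon>..a} K + integral {a..\<delta>} K + integral {\<delta>..1} K"
        using \<epsilon> a a\<delta> \<delta> Henstock_Kurzweil_Integration.integral_combine[where a = \<epsilon> and c = a and b = \<delta> and f = K]
          Henstock_Kurzweil_Integration.integral_combine[where a = \<epsilon> and c = \<delta> and b = 1 and f = K] iK[of \<epsilon>] by simp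
      also have "cmod \<dots> \<le> D + (\<bar>C1\<bar> + \<bar>C2\<bar>) + 2 * ln (1 / \<delta>)"
        by (intro norm_triangle_mono s1 s2 s3)
      finally show "cmod (integral {\<epsilon>..1} (fold_kernel \<psi> x)) \<le> B" by (simp add: B_def K_def)
    qed
  qed
  thus ?thesis using that by blast
qed

section \<open>The upper bound\<close>

lemma refined_gevrey_bound:
  assumes "\<psi> \<in> refined_gevrey k s"
  obtains K where "K > 0" 
    "\<forall>\<^sub>F n in sequentially. \<forall>t\<in>{-1..1}. \<bar>deriv_within {-1..1} n \<psi> t\<bar> \<le> K ^ (n + 1) * fact n * weight k s (real n) ^ n"
proof -
  have sm: "smooth_on {-1..1} \<psi>" using assms by (simp add: refined_gevrey_def)
  obtain K where K: "K > 0" "\<forall>\<^sub>F n in sequentially.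
             (SUP t\<in>{-1..1}. \<bar>deriv_within {-1..1} n \<psi> t\<bar>) \<le> K ^ (n + 1) * fact n * Q_weight k s n ^ n"
    using assms by (auto simp: refined_gevrey_def)
  have "\<forall>\<^sub>F n in sequentially. \<forall>t\<in>{-1..1}. \<bar>deriv_within {-1..1} n \<psi> t\<bar> \<le> K ^ (n + 1) * fact n * weight k s (real n) ^ n"
    using K(2)
  proof eventually_elim
    case (elim n)
    show ?case
    proof
      fix t :: real assume t: "t \<in> {-1..1}"
      have "continuous_on {-1..1} (\<lambda>t. \<bar>deriv_within {-1..1} n \<psi> t\<bar>)"
        by (intro continuous_intros smooth_on_continuous sm)
      hence "bdd_above ((\<lambda>t. \<bar>deriv_within {-1..1} n \<psi> t\<bar>) ` {-1..1})"
        by (intro bounded_imp_bdd_above compact_imp_bounded compact_continuous_image) auto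
      hence "\<bar>deriv_within {-1..1} n \<psi> t\<bar> \<le> (SUP t\<in>{-1..1}. \<bar>deriv_within {-1..1} n \<psi> t\<bar>)"
        by (rule cSUP_upper2[OF _ t]) simp
      thus "\<bar>deriv_within {-1..1} n \<psi> t\<bar> \<le> K ^ (n + 1) * fact n * weight k s (real n) ^ n"
        using elim by (simp add: Q_weight_eq)
    qed
  qed
  thus ?thesis using that K(1) by blast
qed

text \<open>
Below T the odd part is so small that x |o(t)| / t is bounded; above T the kernel is estimated by 2/t.
Here N is ln x rounded up, and T is the range in which Bang's argument gives |o(t)| = O(t e^(-N)).
\<close>

lemma stein_wainger_bound_flat:
  assumes \<psi>: "\<psi> \<in> refined_gevrey k s" and k: "k \<ge> 1" and s: "s > 1"
    and flat: "\<And>n. odd n \<Longrightarrow> deriv_within {-1..1} n \<psi> 0 = 0"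
  obtains A B where "\<forall>\<^sub>F x in at_top. cmod (stein_wainger \<psi> x) \<le> A + B * iter_log (k + 2) x"
proof -
  have sm: "smooth_on {-1..1} \<psi>" using \<psi> by (simp add: refined_gevrey_def)
  have cont: "continuous_on {-1..1} \<psi>" using smooth_on_continuous[OF sm, of 0] by simp
  obtain K where K: "K > 0"
    "\<forall>\<^sub>F n in sequentially. \<forall>t\<in>{-1..1}. \<bar>deriv_within {-1..1} n \<psi> t\<bar> \<le> K ^ (n + 1) * fact n * weight k s (real n) ^ n"
    using refined_gevrey_bound[OF \<psi>] by blast
  define g where "g n = deriv_within {-1..1} n \<psi>" for n
  \<comment> \<open>The derivatives of the odd part of \<psi>.\<close>
  define h where "h n t = (g n t - (-1) ^ n * g n (- t)) / 2" for n t
  have h: "(h n has_real_derivative h (Suc n) t) (at t)" if "\<bar>t\<bar> < 1" for n t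
  proof -
    have "((\<lambda>t. g n (- t)) has_real_derivative - g (Suc n) (- t)) (at t)"
      using smooth_on_DERIV[OF sm, of "- t" n] that by (simp add: DERIV_mirror g_def)
    moreover have "(g n has_real_derivative g (Suc n) t) (at t)"
      using smooth_on_DERIV[OF sm that, of n] by (simp add: g_def)
    ultimately show ?thesis unfolding h_def[abs_def] by (auto intro!: derivative_eq_intros)
  qed
  have hb: "\<forall>\<^sub>F n in sequentially. \<forall>t\<in>{0..<1}. \<bar>h n t\<bar> \<le> K ^ (n + 1) * fact n * weight k s (real n) ^ n"
    using K(2)
  proof eventually_elim
    case (elim n)
    show ?case
    proof
      fix t :: real assume t: "t \<in> {0..<1}"
      have "\<bar>h n t\<bar> \<le> (\<bar>g n t\<bar> + \<bar>(-1) ^ n * g n (- t)\<bar>) / 2"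
        by (simp add: h_def divide_right_mono)
      also have "\<dots> = (\<bar>g n t\<bar> + \<bar>g n (- t)\<bar>) / 2" by (simp add: abs_mult power_abs)
      also have "\<dots> \<le> K ^ (n + 1) * fact n * weight k s (real n) ^ n"
        using elim[rule_format, of t] elim[rule_format, of "- t"] t by (simp add: g_def)
      finally show "\<bar>h n t\<bar> \<le> K ^ (n + 1) * fact n * weight k s (real n) ^ n" .
    qed
  qed
  have h0: "h n 0 = 0" for n using flat[of n] by (cases "odd n") (auto simp: h_def g_def)
  obtain c C where cC: "c > 0" "C > 0"
    "\<forall>\<^sub>F N in sequentially. \<forall>x\<in>{0..<1}. x \<le> c * weight_tail k s (real N) \<longrightarrow> \<bar>h 0 x\<bar> \<le> C * x * exp (- real N)"
    using flat_decay[of h K k s] h hb h0 K k s by auto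
  define A where "A = 2 * C + 2 * ln ((s - 1) / c)"
  define B where "B = 4 * (s - 1)"
  have fN: "filterlim (\<lambda>x. nat \<lceil>ln x\<rceil>) sequentially (at_top :: real filter)"
    unfolding filterlim_at_top
  proof
    fix Z :: nat
    show "\<forall>\<^sub>F x::real in at_top. Z \<le> nat \<lceil>ln x\<rceil>"
      using eventually_ge_at_top[of "exp (real Z)"]
    proof eventually_elim
      case (elim x)
      hence "real Z \<le> ln x" by (smt (verit) exp_gt_zero ln_exp ln_le_cancel_iff)
      thus ?case by linarith
    qed
  qed
  have "((\<lambda>N. c * weight_tail k s (real N)) \<longlongrightarrow> 0) sequentially"
    by (rule tendsto_mult_right_zero) (rule filterlim_compose[OF weight_tail_tendsto_0[OF s] filterlim_real_sequentially])
  hence "\<forall>\<^sub>F N in sequentially. c * weight_tail k s (real N) < 1" by (rule order_tendstoD) simp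
  from eventually_compose_filterlim[OF this fN] eventually_compose_filterlim[OF cC(3) fN]
    eventually_gt_at_top[of "exp (iter_exp (k + 1) 1)"]
  have "\<forall>\<^sub>F x in at_top. cmod (stein_wainger \<psi> x) \<le> A + B * iter_log (k + 2) x"
  proof eventually_elim
    case (elim x)
    define N where "N = nat \<lceil>ln x\<rceil>"
    have x0: "x > 1" using elim(3) one_less_exp_iff[of "iter_exp (k + 1) 1"] iter_exp_ge[of 1 "k + 1"] by linarith
    have lx: "iter_exp (k + 1) 1 \<le> ln x" using elim(3) x0 by (simp add: ln_ge_iff)
    hence lx1: "1 \<le> ln x" using iter_exp_ge[of 1 "k + 1"] by linarith
    have N: "ln x \<le> real N" "real N \<le> 2 * ln x" using lx1 by (auto simp: N_def) linarith
    have "iter_log (k + 1) (real N) \<le> real N / ln x * iter_log (k + 1) (ln x)"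
      by (rule iter_log_ratio[OF lx N(1)]) simp
    also have "\<dots> \<le> 2 * iter_log (k + 1) (ln x)"
      using N lx1 iter_log_ge_1[OF lx, of "k + 1"] by (intro mult_right_mono) (auto simp: field_simps)
    also have "iter_log (k + 1) (ln x) = iter_log (k + 2) x" by (simp add: iter_log_Suc')
    finally have logN: "ln (iter_log k (real N)) \<le> 2 * iter_log (k + 2) x" by (simp add: iter_log_Suc)
    have lN: "iter_log k (real N) \<ge> 1"
      using iter_log_ge_1[of "k + 1" "real N" k] lx N by simp
    define T where "T = c * weight_tail k s (real N)"
    have T: "0 < T" "T < 1" using lN cC(1) s elim(1) by (auto simp: T_def weight_tail_def N_def)
    have lnT: "ln (1 / T) \<le> ln ((s - 1) / c) + 2 * (s - 1) * iter_log (k + 2) x"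
    proof -
      have "1 / T = (s - 1) / c * iter_log k (real N) powr (s - 1)"
        using lN cC(1) s by (simp add: T_def weight_tail_def powr_diff field_simps)
      hence "ln (1 / T) = ln ((s - 1) / c) + (s - 1) * ln (iter_log k (real N))"
        using lN cC(1) s ln_mult[of "(s - 1) / c" "iter_log k (real N) powr (s - 1)"] by (simp add: ln_powr)
      also have "\<dots> \<le> ln ((s - 1) / c) + (s - 1) * (2 * iter_log (k + 2) x)"
        using logN s by (intro add_left_mono mult_left_mono) auto
      finally show ?thesis by (simp add: algebra_simps)
    qed
    have ex: "exp (- real N) * x \<le> 1"
    proof -
      have "x = exp (ln x)" using x0 by simp
      also have "\<dots> \<le> exp (real N)" using N by simp
      finally show ?thesis by (simp add: exp_minus field_simps)
    qed
    show ?case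
    proof (rule stein_wainger_bound[OF sm T(1)])
      fix \<epsilon> assume \<epsilon>: "0 < \<epsilon>" "\<epsilon> < T"
      have "cmod (integral {\<epsilon>..T} (fold_kernel \<psi> x)) \<le> \<bar>x\<bar> * (2 * C * exp (- real N)) * T"
      proof (rule fold_kernel_integral_small_bound[OF cont])
        fix t assume t: "0 < t" "t \<le> T"
        have "\<bar>h 0 t\<bar> \<le> C * t * exp (- real N)"
          using elim(2) t T by (auto simp: T_def N_def)
        thus "\<bar>\<psi> t - \<psi> (- t)\<bar> \<le> 2 * C * exp (- real N) * t" by (simp add: h_def g_def mult_ac)
      qed (use \<epsilon> T cC in auto)
      also have "\<dots> = 2 * C * T * (exp (- real N) * x)" using x0 by simp
      also have "\<dots> \<le> 2 * C * 1 * 1" using ex T cC x0 by (intro mult_mono) auto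
      finally have 1: "cmod (integral {\<epsilon>..T} (fold_kernel \<psi> x)) \<le> 2 * C" by simp
      have 2: "cmod (integral {T..1} (fold_kernel \<psi> x)) \<le> 2 * ln (1 / T)"
        using T by (intro fold_kernel_integral_log_bound cont) auto
      have "fold_kernel \<psi> x integrable_on {\<epsilon>..1}"
        using \<epsilon> by (intro integrable_continuous_interval continuous_on_fold_kernel cont) auto
      hence "integral {\<epsilon>..1} (fold_kernel \<psi> x) = integral {\<epsilon>..T} (fold_kernel \<psi> x) + integral {T..1} (fold_kernel \<psi> x)"
        using \<epsilon> T Henstock_Kurzweil_Integration.integral_combine[where a = \<epsilon> and c = T and b = 1 and f = "fold_kernel \<psi> x"] by simp
      also have "cmod \<dots> \<le> 2 * C + 2 * ln (1 / T)" by (intro norm_triangle_mono 1 2)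
      also have "\<dots> \<le> A + B * iter_log (k + 2) x" using lnT by (simp add: A_def B_def algebra_simps)
      finally show "cmod (integral {\<epsilon>..1} (fold_kernel \<psi> x)) \<le> A + B * iter_log (k + 2) x" .
    qed
  qed
  thus ?thesis using that by blast
qed

lemma stein_wainger_bigo:
  assumes "\<psi> \<in> refined_gevrey k s" "k \<ge> 1" "s > 1"
  shows "(\<lambda>x. cmod (stein_wainger \<psi> x)) \<in> O[at_top](iter_log (k + 2))"
proof -
  have sm: "smooth_on {-1..1} \<psi>" using assms by (simp add: refined_gevrey_def)
  obtain A B where AB: "\<forall>\<^sub>F x in at_top. cmod (stein_wainger \<psi> x) \<le> A + B * iter_log (k + 2) x"
  proof (cases "\<forall>n. odd n \<longrightarrow> deriv_within {-1..1} n \<psi> 0 = 0")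
    case True
    thus ?thesis using stein_wainger_bound_flat[OF assms] that by blast
  next
    case False
    then obtain n where "odd n" "deriv_within {-1..1} n \<psi> 0 \<noteq> 0" by blast
    then obtain B where "\<forall>\<^sub>F x in at_top. cmod (stein_wainger \<psi> x) \<le> B"
      using stein_wainger_bounded_nonflat[OF sm] by metis
    thus ?thesis using that[of B 0] by simp
  qed
  have "\<forall>\<^sub>F x in at_top. 1 \<le> iter_log (k + 2) x"
    using filterlim_iter_log[of "k + 2"] unfolding filterlim_at_top by blast
  hence "\<forall>\<^sub>F x in at_top. norm (cmod (stein_wainger \<psi> x)) \<le> (\<bar>A\<bar> + B) * norm (iter_log (k + 2) x)"
    using AB
  proof eventually_elim
    case (elim x)
    have "A \<le> \<bar>A\<bar> * iter_log (k + 2) x"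
      using mult_left_mono[OF elim(1), of "\<bar>A\<bar>"] by simp
    thus ?case using elim by (simp add: algebra_simps)
  qed
  thus ?thesis by (rule bigoI)
qed

section \<open>Smooth steps of Gevrey regularity\<close>

text \<open>
Convolution with the normalised indicator of [0,d], rescaled to the unit interval so that bounds on
f over [x-d,x] carry over without a normalising factor.
\<close>

definition moving_avg :: "real \<Rightarrow> (real \<Rightarrow> real) \<Rightarrow> real \<Rightarrow> real" where
  "moving_avg d f x = integral {0..1} (\<lambda>y. f (x - d * y))"

text \<open>
Averaging trades a derivative for a difference quotient; this is what keeps the derivatives of the
smooth step below explicit.
\<close>

lemma moving_avg_has_derivative:
  assumes d: "d > 0" and f: "continuous_on UNIV f"
  shows "(moving_avg d f has_real_derivative (f x - f (x - d)) / d) (at x)"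
proof -
  have "isCont f x" for x using f by (simp add: continuous_on_eq_continuous_at)
  then obtain F where F: "\<And>x. (F has_vector_derivative f x) (at x)"
    using einterval_antiderivative[of "-\<infinity>" "\<infinity>" f] by auto
  have F': "(F has_real_derivative f x) (at x)" for x
    using F by (simp add: has_real_derivative_iff_has_vector_derivative)
  have "moving_avg d f = (\<lambda>x. (F x - F (x - d)) / d)"
  proof
    fix x
    have "((\<lambda>y. f (x - d * y)) has_integral (- F (x - d * 1) / d - - F (x - d * 0) / d)) {0..1}"
    proof (rule fundamental_theorem_of_calculus)
      fix y :: real
      have "((\<lambda>y. F (x - d * y)) has_real_derivative f (x - d * y) * (- d)) (at y within {0..1})"
        by (rule DERIV_chain2[OF F']) (auto intro!: derivative_eq_intros)
      hence "((\<lambda>y. - F (x - d * y) / d) has_real_derivative f (x - d * y)) (at y within {0..1})"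
        using d by (auto intro!: derivative_eq_intros)
      thus "((\<lambda>y. - F (x - d * y) / d) has_vector_derivative f (x - d * y)) (at y within {0..1})"
        by (simp add: has_real_derivative_iff_has_vector_derivative)
    qed simp
    thus "moving_avg d f x = (F x - F (x - d)) / d"
      unfolding moving_avg_def by (simp add: integral_unique diff_divide_distrib)
  qed
  moreover have "((\<lambda>x. (F x - F (x - d)) / d) has_real_derivative (f x - f (x - d)) / d) (at x)"
  proof -
    have "((\<lambda>x. F (x - d)) has_real_derivative f (x - d) * 1) (at x)"
      by (rule DERIV_chain2[OF F']) (auto intro!: derivative_eq_intros)
    thus ?thesis using F'[of x] d by (auto intro!: derivative_eq_intros)
  qed
  ultimately show ?thesis by simp
qed

lemma continuous_on_moving_avg:
  "d > 0 \<Longrightarrow> continuous_on UNIV f \<Longrightarrow> continuous_on UNIV (moving_avg d f)"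
  using moving_avg_has_derivative DERIV_isCont by (metis continuous_at_imp_continuous_on)

lemma moving_avg_integrable:
  fixes f :: "real \<Rightarrow> real"
  assumes "continuous_on UNIV f"
  shows "(\<lambda>y. f (x - d * y)) integrable_on {0..1::real}"
  by (rule integrable_continuous_interval, rule continuous_on_compose2[OF assms]) (auto intro!: continuous_intros)

lemma moving_avg_close:
  assumes "continuous_on UNIV f" "continuous_on UNIV g" 
    "\<And>y. x - d \<le> y \<Longrightarrow> y \<le> x \<Longrightarrow> \<bar>f y - g y\<bar> \<le> e" "d > 0"
  shows "\<bar>moving_avg d f x - moving_avg d g x\<bar> \<le> e"
proof -
  have "moving_avg d f x - moving_avg d g x = integral {0..1} (\<lambda>y. f (x - d * y) - g (x - d * y))"
    unfolding moving_avg_def by (simp add: integral_diff moving_avg_integrable assms)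
  also have "norm \<dots> \<le> integral {0..1} (\<lambda>y::real. e)"
  proof (rule integral_norm_bound_integral)
    show "(\<lambda>y. f (x - d * y) - g (x - d * y)) integrable_on {0..1}"
      by (intro integrable_diff moving_avg_integrable assms)
    fix y :: real assume y: "y \<in> {0..1}"
    hence "d * y \<le> d * 1" using assms by (intro mult_left_mono) auto
    thus "norm (f (x - d * y) - g (x - d * y)) \<le> e"
      using assms(3)[of "x - d * y"] y assms(4) by simp
  qed auto
  finally show ?thesis by simp
qed

lemma moving_avg_const_on:
  assumes "\<And>y. x - d \<le> y \<Longrightarrow> y \<le> x \<Longrightarrow> f y = c" "d > 0"
  shows "moving_avg d f x = c"
proof -
  have "moving_avg d f x = integral {0..1} (\<lambda>y::real. c)"
    unfolding moving_avg_def
  proof (rule integral_cong)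
    fix y :: real assume y: "y \<in> {0..1}"
    hence "d * y \<le> d * 1" using assms by (intro mult_left_mono) auto
    thus "f (x - d * y) = c" using assms y by auto
  qed
  thus ?thesis by simp
qed

definition ramp :: "real \<Rightarrow> real" where
  "ramp x = max 0 (min 1 x)"

lemma continuous_on_ramp: "continuous_on A ramp"
  unfolding ramp_def[abs_def] by (intro continuous_intros)

text \<open>
The averages with the widths \<delta> n, ..., \<delta> (n+m-1), the innermost one applied to the ramp having the last
width.  The starting index n is kept as an argument because the limits for n and for n + 1 are related by
one average.
\<close>

primrec avg_iter :: "(nat \<Rightarrow> real) \<Rightarrow> nat \<Rightarrow> nat \<Rightarrow> real \<Rightarrow> real" where
  "avg_iter \<delta> 0 n = ramp"
| "avg_iter \<delta> (Suc m) n = moving_avg (\<delta> n) (avg_iter \<delta> m (Suc n))"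

primrec diff_iter :: "(nat \<Rightarrow> real) \<Rightarrow> nat \<Rightarrow> (real \<Rightarrow> real) \<Rightarrow> real \<Rightarrow> real" where
  "diff_iter \<delta> 0 g = g"
| "diff_iter \<delta> (Suc n) g = diff_iter \<delta> n (\<lambda>x. (g x - g (x - \<delta> n)) / \<delta> n)"

lemma diff_iter_has_derivative:
  assumes "\<And>x. (g has_real_derivative g' x) (at x)"
  shows "(diff_iter \<delta> n g has_real_derivative diff_iter \<delta> n g' x) (at x)"
  using assms
proof (induction n arbitrary: g g')
  case (Suc n)
  have "((\<lambda>x. (g x - g (x - \<delta> n)) / \<delta> n) has_real_derivative (g' x - g' (x - \<delta> n)) / \<delta> n) (at x)" for x
  proof -
    have "((\<lambda>x. g (x - \<delta> n)) has_real_derivative g' (x - \<delta> n) * 1) (at x)"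
      by (rule DERIV_chain2[OF Suc.prems]) (auto intro!: derivative_eq_intros)
    thus ?thesis using Suc.prems[of x] by (auto intro!: DERIV_cdivide DERIV_diff)
  qed
  from Suc.IH[OF this] show ?case by simp
qed simp

lemma diff_iter_bound:
  assumes "\<And>x. \<bar>g x\<bar> \<le> B" "\<And>i. \<delta> i > 0"
  shows "\<bar>diff_iter \<delta> n g x\<bar> \<le> B * (\<Prod>i<n. 2 / \<delta> i)"
  using assms(1)
proof (induction n arbitrary: g B)
  case (Suc n)
  have "\<bar>(g x - g (x - \<delta> n)) / \<delta> n\<bar> \<le> B * (2 / \<delta> n)" for x
  proof -
    have "\<bar>g x - g (x - \<delta> n)\<bar> \<le> 2 * B" using Suc.prems[of x] Suc.prems[of "x - \<delta> n"] by linarith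
    thus ?thesis using assms(2)[of n] by (simp add: field_simps)
  qed
  from Suc.IH[OF this] show ?case by (simp add: mult_ac)
qed simp

text \<open>
Let v_n be the limit of the averages of the ramp with the widths \<delta> n, \<delta> (n+1), ... .  It exists
uniformly because one further average moves the 1-Lipschitz ramp by at most its width.  Since v_n is the
average of v_(n+1) of width \<delta> n, its derivative is a difference quotient of v_(n+1), and hence the n-th
derivative of v_0 consists of n nested difference quotients of v_n.  As |v_n| \<le> 1,
each quotient costs at most 2/\<delta> i.  No convergence of derivatives has to be discussed.
\<close>

lemma smooth_step_exists:
  fixes \<delta> :: "nat \<Rightarrow> real"
  assumes \<delta>: "\<And>i. \<delta> i > 0" and summable: "summable \<delta>"
  obtains \<eta> :: "nat \<Rightarrow> real \<Rightarrow> real" where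
    "\<And>n x. (\<eta> n has_real_derivative \<eta> (Suc n) x) (at x)"
    "\<And>n x. \<bar>\<eta> n x\<bar> \<le> (\<Prod>i<n. 2 / \<delta> i)"
    "\<And>x. x \<le> 0 \<Longrightarrow> \<eta> 0 x = 0"
    "\<And>x. 1 + suminf \<delta> \<le> x \<Longrightarrow> \<eta> 0 x = 1"
proof -
  define w where "w = avg_iter \<delta>"
  have cont: "continuous_on UNIV (w m n)" for m n
    by (induction m arbitrary: n) (auto simp: w_def continuous_on_ramp continuous_on_moving_avg \<delta>)
  have abs1: "\<bar>w m n x\<bar> \<le> 1" for m n x
  proof (induction m arbitrary: n x)
    case (Suc m)
    have "moving_avg (\<delta> n) (\<lambda>_. 0) x = 0" by (rule moving_avg_const_on) (use \<delta> in auto)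
    thus ?case using moving_avg_close[of "w m (Suc n)" "\<lambda>_. 0" x "\<delta> n" 1] Suc cont \<delta>
      by (simp add: w_def)
  qed (simp add: w_def ramp_def)
  have zero: "w m n x = 0" if "x \<le> 0" for m n x
    using that
    by (induction m arbitrary: n x) (auto simp: w_def ramp_def intro!: moving_avg_const_on \<delta>)
  have one: "w m n x = 1" if "1 + (\<Sum>i<m. \<delta> (n + i)) \<le> x" for m n x
    using that
  proof (induction m arbitrary: n x)
    case (Suc m)
    have "w m (Suc n) y = 1" if "x - \<delta> n \<le> y" for y
      by (rule Suc.IH) (use Suc.prems that in \<open>simp add: sum.lessThan_Suc_shift del: sum.lessThan_Suc\<close>)
    thus ?case by (auto simp: w_def intro!: moving_avg_const_on \<delta>)
  qed (simp add: w_def ramp_def)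
  have cauchy: "\<bar>w (Suc m) n x - w m n x\<bar> \<le> \<delta> (n + m)" for m n x
  proof (induction m arbitrary: n x)
    case 0
    have "moving_avg (\<delta> n) (\<lambda>_. ramp x) x = ramp x" by (rule moving_avg_const_on) (use \<delta> in auto)
    moreover have "\<bar>moving_avg (\<delta> n) ramp x - moving_avg (\<delta> n) (\<lambda>_. ramp x) x\<bar> \<le> \<delta> n"
      using \<delta>[of n] by (intro moving_avg_close continuous_on_ramp) (auto simp: ramp_def)
    ultimately show ?case by (simp add: w_def)
  next
    case (Suc m)
    have "\<bar>moving_avg (\<delta> n) (w (Suc m) (Suc n)) x - moving_avg (\<delta> n) (w m (Suc n)) x\<bar> \<le> \<delta> (Suc n + m)"
      using Suc.IH[of "Suc n"] \<delta> cont by (intro moving_avg_close) auto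
    thus ?case by (simp add: w_def)
  qed
  define v where "v n x = (\<Sum>i. w (Suc i) n x - w i n x) + ramp x" for n x
  have ul: "uniform_limit UNIV (\<lambda>m x. w m n x) (v n) sequentially" for n
  proof -
    have tele: "(\<Sum>i<m. w (Suc i) n x - w i n x) = w m n x - w 0 n x" for m x
      by (rule sum_lessThan_telescope[of "\<lambda>i. w i n x"])
    have "uniform_limit UNIV (\<lambda>m x. \<Sum>i<m. w (Suc i) n x - w i n x) (\<lambda>x. \<Sum>i. w (Suc i) n x - w i n x) sequentially"
      by (rule Weierstrass_m_test[where M = "\<lambda>i. \<delta> (n + i)"])
         (use cauchy summable_ignore_initial_segment[OF summable, of n] in \<open>auto simp: add.commute\<close>)
    hence "uniform_limit UNIV (\<lambda>m x. w m n x - w 0 n x) (\<lambda>x. \<Sum>i. w (Suc i) n x - w i n x) sequentially"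
      by (simp only: tele)
    hence "uniform_limit UNIV (\<lambda>m x. (w m n x - w 0 n x) + ramp x)
        (\<lambda>x. (\<Sum>i. w (Suc i) n x - w i n x) + ramp x) sequentially"
      by (intro uniform_limit_add uniform_limit_const)
    thus ?thesis by (simp add: v_def[abs_def] w_def)
  qed
  have lim: "(\<lambda>m. w m n x) \<longlonglongrightarrow> v n x" for n x
    using tendsto_uniform_limitI[OF ul] by simp
  have v_cont: "continuous_on UNIV (v n)" for n
    by (rule uniform_limit_theorem[OF _ ul]) (use cont in auto)
  have v_eq: "v n = moving_avg (\<delta> n) (v (Suc n))" for n
  proof
    fix x
    have "(\<lambda>m. w (Suc m) n x) \<longlonglongrightarrow> moving_avg (\<delta> n) (v (Suc n)) x"
    proof (rule metric_LIMSEQ_I)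
      fix e :: real assume e: "e > 0"
      have "\<forall>\<^sub>F m in sequentially. \<forall>y\<in>UNIV. dist (w m (Suc n) y) (v (Suc n) y) < e / 2"
        using uniform_limitD[OF ul, of "e / 2" "Suc n"] e by simp
      then obtain N where N: "\<And>m y. N \<le> m \<Longrightarrow> \<bar>w m (Suc n) y - v (Suc n) y\<bar> < e / 2"
        unfolding eventually_sequentially dist_real_def by blast
      have "dist (w (Suc m) n x) (moving_avg (\<delta> n) (v (Suc n)) x) < e" if "N \<le> m" for m
      proof -
        have "\<bar>moving_avg (\<delta> n) (w m (Suc n)) x - moving_avg (\<delta> n) (v (Suc n)) x\<bar> \<le> e / 2"
          using N[OF that] \<delta> by (intro moving_avg_close cont v_cont) (auto intro: less_imp_le)
        thus ?thesis using e by (simp add: w_def dist_real_def)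
      qed
      thus "\<exists>N. \<forall>m\<ge>N. dist (w (Suc m) n x) (moving_avg (\<delta> n) (v (Suc n)) x) < e" by blast
    qed
    thus "v n x = moving_avg (\<delta> n) (v (Suc n)) x"
      using LIMSEQ_Suc[OF lim] LIMSEQ_unique by blast
  qed
  define \<eta> where "\<eta> n = diff_iter \<delta> n (v n)" for n
  show ?thesis
  proof (rule that)
    fix n x
    have "(v n has_real_derivative (v (Suc n) x - v (Suc n) (x - \<delta> n)) / \<delta> n) (at x)" for x
      by (subst v_eq) (rule moving_avg_has_derivative[OF \<delta> v_cont])
    from diff_iter_has_derivative[OF this, of \<delta> n]
    show "(\<eta> n has_real_derivative \<eta> (Suc n) x) (at x)" by (simp add: \<eta>_def)
    have "\<bar>v n x\<bar> \<le> 1" for x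
      by (rule tendsto_upperbound[OF tendsto_rabs[OF lim]]) (simp_all add: abs1)
    from diff_iter_bound[OF this \<delta>] show "\<bar>\<eta> n x\<bar> \<le> (\<Prod>i<n. 2 / \<delta> i)" by (simp add: \<eta>_def)
  next
    fix x :: real assume "x \<le> 0"
    thus "\<eta> 0 x = 0" using lim[of 0 x] zero[of x _ 0] by (simp add: \<eta>_def LIMSEQ_const_iff)
  next
    fix x assume x: "1 + suminf \<delta> \<le> x"
    have "w m 0 x = 1" for m
    proof (rule one)
      have "(\<Sum>i<m. \<delta> i) \<le> suminf \<delta>"
        by (rule sum_le_suminf[OF summable]) (use \<delta> in \<open>auto intro: less_imp_le\<close>)
      thus "1 + (\<Sum>i<m. \<delta> (0 + i)) \<le> x" using x by simp
    qed
    thus "\<eta> 0 x = 1" using lim[of 0 x] by (simp add: \<eta>_def LIMSEQ_const_iff)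
  qed
qed

text \<open>
The widths 1/(i Q(i)), shifted to where Q is controlled, are summable because s > 1, and the product of their
inverses is at most C^n n! Q(n)^n.
\<close>

lemma gevrey_step_exists:
  assumes k: "k \<ge> 1" and s: "s > 1"
  obtains \<eta> :: "nat \<Rightarrow> real \<Rightarrow> real" and R K where
    "R > 0" "K > 0"
    "\<And>n x. (\<eta> n has_real_derivative \<eta> (Suc n) x) (at x)"
    "\<And>x. x \<le> 0 \<Longrightarrow> \<eta> 0 x = 0"
    "\<And>x. R \<le> x \<Longrightarrow> \<eta> 0 x = 1"
    "\<And>n. \<exists>B. \<forall>x. \<bar>\<eta> n x\<bar> \<le> B"
    "\<forall>\<^sub>F n in sequentially. \<forall>x. \<bar>\<eta> n x\<bar> \<le> K ^ n * fact n * weight k s (real n) ^ n"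
proof -
  define X where "X = nat \<lceil>iter_exp k 1\<rceil>"
  have X: "iter_exp k 1 \<le> real X" unfolding X_def by linarith
  have X1: "1 \<le> real X" using X iter_exp_ge[of 1 k] by linarith
  define g where "g i = (real i + real X + 1) * weight k s (real i + real X + 1)" for i
  have w1: "1 \<le> weight k s (real i + real X + 1)" for i
    using weight_ge_1[of k "real i + real X + 1" s] X s by simp
  have g1: "g i \<ge> 1" for i using w1[of i] X1 mult_mono[of 1 "real i + real X + 1" 1 "weight k s (real i + real X + 1)"]
    by (simp add: g_def)
  have g_mono: "g i \<le> g j" if "i \<le> j" for i j
    unfolding g_def using that w1[of i] X s by (intro mult_mono weight_mono) auto
  define \<delta> where "\<delta> i = 1 / g i" for i
  have \<delta>: "\<delta> i > 0" for i using g1[of i] by (simp add: \<delta>_def)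
  have weight_tail0: "0 \<le> weight_tail k s (real n + real X)" for n
    using s by (simp add: weight_tail_def)
  have sums: "(\<Sum>i<n. \<delta> i) \<le> weight_tail k s (real X) - weight_tail k s (real n + real X)" for n
  proof (induction n)
    case (Suc n)
    have "\<delta> n \<le> weight_tail k s (real n + real X) - weight_tail k s (real (Suc n) + real X)"
      using weight_tail_diff_bounds(1)[of k "real n + real X" "real n + real X + 1" s] X k s
      by (simp add: \<delta>_def g_def add_ac)
    thus ?case using Suc by simp
  qed simp
  have summable: "summable \<delta>"
  proof (rule summableI_nonneg_bounded)
    show "(\<Sum>i<n. \<delta> i) \<le> weight_tail k s (real X)" for n using sums[of n] weight_tail0[of n] by linarith
  qed (use \<delta> in \<open>auto intro: less_imp_le\<close>)
  obtain \<eta> :: "nat \<Rightarrow> real \<Rightarrow> real" where \<eta>: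
    "\<And>n x. (\<eta> n has_real_derivative \<eta> (Suc n) x) (at x)"
    "\<And>n x. \<bar>\<eta> n x\<bar> \<le> (\<Prod>i<n. 2 / \<delta> i)"
    "\<And>x. x \<le> 0 \<Longrightarrow> \<eta> 0 x = 0"
    "\<And>x. 1 + suminf \<delta> \<le> x \<Longrightarrow> \<eta> 0 x = 1"
    using smooth_step_exists[of \<delta>, OF \<delta> summable] by blast
  define p where "p = s + real (k - 1)"
  define K where "K = 4 * 2 powr p * exp 1"
  have ev: "\<forall>\<^sub>F n in sequentially. \<forall>x. \<bar>\<eta> n x\<bar> \<le> K ^ n * fact n * weight k s (real n) ^ n"
    using eventually_ge_at_top[of "X + 1"]
  proof eventually_elim
    case (elim n)
    have n: "iter_exp k 1 \<le> real n" "1 \<le> real n" using elim X X1 by auto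
    have wn: "1 \<le> weight k s (real n)" using weight_ge_1[OF n(1)] s by simp
    have gn: "2 * g n \<le> 4 * 2 powr p * (real n * weight k s (real n))" 
    proof -
      have r: "(real n + real X + 1) / real n \<le> 2" "1 \<le> (real n + real X + 1) / real n"
        using elim n by (auto simp: field_simps)
      have "weight k s (real n + real X + 1) \<le> ((real n + real X + 1) / real n) powr p * weight k s (real n)"
        unfolding p_def using n s by (intro weight_ratio) auto
      also have "\<dots> \<le> 2 powr p * weight k s (real n)"
        using r wn s by (intro mult_right_mono powr_mono2) (auto simp: p_def)
      finally have "g n \<le> (2 * real n) * (2 powr p * weight k s (real n))"
        unfolding g_def using elim w1[of n] by (intro mult_mono) auto
      thus ?thesis by (simp add: mult_ac)
    qed
    show ?case
    proof
      fix x
      have "\<bar>\<eta> n x\<bar> \<le> (\<Prod>i<n. 2 * g i)" using \<eta>(2)[of n x] by (simp add: \<delta>_def)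
      also have "\<dots> \<le> (\<Prod>i<n. 2 * g n)" 
        using g_mono g1 by (intro prod_mono) (auto intro: order.trans[OF zero_le_one])
      also have "\<dots> = (2 * g n) ^ n" by simp
      also have "\<dots> \<le> (4 * 2 powr p * (real n * weight k s (real n))) ^ n" 
        using gn g1[of n] by (intro power_mono) auto
      also have "\<dots> = (4 * 2 powr p) ^ n * weight k s (real n) ^ n * real n ^ n"
        by (simp add: power_mult_distrib)
      also have "\<dots> \<le> (4 * 2 powr p) ^ n * weight k s (real n) ^ n * (exp (real n) * fact n)"
        using wn by (intro mult_left_mono power_self_le_exp_fact) auto
      also have "\<dots> = K ^ n * fact n * weight k s (real n) ^ n"
        by (simp add: K_def power_mult_distrib mult_ac flip: exp_of_nat_mult)
      finally show "\<bar>\<eta> n x\<bar> \<le> K ^ n * fact n * weight k s (real n) ^ n" .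
    qed
  qed
  have "0 \<le> suminf \<delta>" using \<delta> by (intro suminf_nonneg summable) (auto intro: less_imp_le)
  hence "1 + suminf \<delta> > 0" by simp
  moreover have "K > 0" by (simp add: K_def)
  moreover have "\<exists>B. \<forall>x. \<bar>\<eta> n x\<bar> \<le> B" for n using \<eta>(2) by blast
  ultimately show ?thesis using that[of "1 + suminf \<delta>" K \<eta>] \<eta> ev by blast
qed

section \<open>Sharpness: a staircase phase\<close>

lemma weight_split:
  assumes "iter_log k x > 0"
  shows "weight k s x * iter_log k x powr e = weight k (s + e) x"
  using assms by (simp add: weight_def powr_add mult_ac)

lemma refined_gevrey_intro:
  fixes f :: "nat \<Rightarrow> real \<Rightarrow> real"
  assumes deriv: "\<And>n t. (f n has_real_derivative f (Suc n) t) (at t)"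
    and "K > 0" and bound: "\<forall>\<^sub>F n in sequentially. \<forall>t. \<bar>f n t\<bar> \<le> K ^ (n + 1) * fact n * weight k s (real n) ^ n"
  shows "f 0 \<in> refined_gevrey k s"
proof -
  have d: "(f n has_real_derivative f (Suc n) t) (at t within {-1..1})" for n t
    using deriv has_field_derivative_at_within by blast
  have eq: "deriv_within {-1..1} n (f 0) t = f n t" if "t \<in> {-1..1}" for n t
    by (rule deriv_within_eqI[where f = f, OF d]) (use that in auto)
  have "smooth_on {-1..1} (f 0)"
    unfolding smooth_on_def differentiable_on_def
  proof (intro allI ballI)
    fix n and t :: real assume t: "t \<in> {-1..1}"
    have "(deriv_within {-1..1} n (f 0) has_real_derivative f (Suc n) t) (at t within {-1..1})"
      using d[of n t] unfolding has_real_derivative_iff_has_vector_derivative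
      by (rule has_vector_derivative_transform[OF t, rotated]) (use eq in auto)
    thus "deriv_within {-1..1} n (f 0) differentiable at t within {-1..1}"
      using real_differentiable_def by blast
  qed
  moreover have "\<forall>\<^sub>F n in sequentially. (SUP t\<in>{-1..1}. \<bar>deriv_within {-1..1} n (f 0) t\<bar>)
               \<le> K ^ (n + 1) * fact n * Q_weight k s n ^ n"
    using bound by eventually_elim (intro cSUP_least, auto simp: eq Q_weight_eq)
  ultimately show ?thesis using assms(2) by (auto simp: refined_gevrey_def)
qed

text \<open>
The phase is the sum of the steps (b_j - b_(j+1)) \<eta>(R (4^j t - 1)) with b_j = \<pi>/3^(N_j).  The j-th step rises
between 4^(-j) and 2/4^j, so between 2/4^j and 4/4^j exactly the steps with index at least j are
complete, and they telescope to b_j.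
\<close>

lemma gevrey_staircase_exists:
  assumes k: "k \<ge> 1" and s: "s > 1"
  obtains \<psi> :: "real \<Rightarrow> real" and N :: "nat \<Rightarrow> nat" and \<beta> :: real where
    "\<psi> \<in> refined_gevrey k s"
    "\<And>t. t \<le> 0 \<Longrightarrow> \<psi> t = 0"
    "\<And>j t. 2 / 4 ^ j \<le> t \<Longrightarrow> t \<le> 4 / 4 ^ j \<Longrightarrow> \<psi> t = pi / 3 ^ N j"
    "mono N" "\<And>j. j \<le> N j" "\<beta> \<ge> 0" "\<And>j. real (N j) \<le> 3 * real j * iter_exp (k + 1) (\<beta> * real j) + 1"
proof -
  define s' where "s' = (1 + s) / 2"
  define e where "e = s - s'"
  have e: "e > 0" "s' > 1" "s' + e = s" using s by (auto simp: e_def s'_def)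
  obtain \<eta> :: "nat \<Rightarrow> real \<Rightarrow> real" and R K where \<eta>:
    "R > 0" "K > 0"
    "\<And>n x. (\<eta> n has_real_derivative \<eta> (Suc n) x) (at x)"
    "\<And>x. x \<le> 0 \<Longrightarrow> \<eta> 0 x = 0"
    "\<And>x. R \<le> x \<Longrightarrow> \<eta> 0 x = 1"
    "\<And>n. \<exists>B. \<forall>x. \<bar>\<eta> n x\<bar> \<le> B"
    "\<forall>\<^sub>F n in sequentially. \<forall>x. \<bar>\<eta> n x\<bar> \<le> K ^ n * fact n * weight k s' (real n) ^ n"
  proof -
    show ?thesis by (rule gevrey_step_exists[OF k e(2)]) (rule that; assumption)
  qed
  \<comment> \<open>Chosen such that 16^j = exp (\<beta> j)^e: beyond n = E j the gain in the weight beats 16^j.\<close>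
  define \<beta> where "\<beta> = ln 16 / e"
  have \<beta>: "\<beta> \<ge> 0" using e by (simp add: \<beta>_def)
  define E where "E j = iter_exp (k + 1) (\<beta> * real j)" for j
  have E1: "1 \<le> E j" for j
  proof -
    have "0 \<le> \<beta> * real j" using \<beta> by simp
    also have "\<dots> \<le> iter_exp k (\<beta> * real j)" by (rule iter_exp_ge)
    finally show ?thesis by (simp add: E_def)
  qed
  have E_mono: "E i \<le> E j" if "i \<le> j" for i j
    unfolding E_def using that \<beta> by (intro iter_exp_mono mult_left_mono) auto
  \<comment> \<open>For n < E j this gives 16^(jn) \<le> 27^(jn) \<le> 3^(N j).\<close>
  define N where "N j = nat \<lceil>3 * real j * E j\<rceil>" for j
  have N_ge: "3 * real j * E j \<le> real (N j)" for j unfolding N_def by linarith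
  have N_le: "real (N j) \<le> 3 * real j * E j + 1" for j
    using E1[of j] mult_nonneg_nonneg[of "3 * real j" "E j"] unfolding N_def by linarith
  have N_mono: "mono N"
    unfolding N_def by (intro monoI nat_mono ceiling_mono mult_mono E_mono) (use E1 in \<open>auto intro: order.trans[OF zero_le_one]\<close>)
  have jN: "j \<le> N j" for j
  proof -
    have "real j * 1 \<le> 3 * real j * E j" using E1[of j] by (intro mult_mono) auto
    thus ?thesis using N_ge[of j] by linarith
  qed
  define b where "b j = pi / 3 ^ N j" for j
  have b: "0 < b j" "b j \<le> pi" for j by (auto simp: b_def divide_le_eq)
  have b_mono: "b j \<le> b i" if "i \<le> j" for i j
    unfolding b_def using monoD[OF N_mono that] by (intro divide_left_mono power_increasing) auto
  have b_lim: "b \<longlonglongrightarrow> 0"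
  proof (rule tendsto_sandwich[where f = "\<lambda>_. 0" and h = "\<lambda>j. pi * (1 / 3) ^ j"])
    show "\<forall>\<^sub>F j in sequentially. b j \<le> pi * (1 / 3) ^ j"
    proof (rule always_eventually, rule allI)
      fix j
      have "b j \<le> pi / 3 ^ j" unfolding b_def using jN by (intro divide_left_mono power_increasing) auto
      thus "b j \<le> pi * (1 / 3) ^ j" by (simp add: power_one_over field_simps)
    qed
    show "(\<lambda>j. pi * (1 / 3) ^ j) \<longlonglongrightarrow> 0"
      by (rule tendsto_mult_right_zero) (rule LIMSEQ_realpow_zero, auto)
  qed (use b in \<open>auto intro: always_eventually less_imp_le\<close>)
  define d where "d j = b j - b (Suc j)" for j
  have d: "0 \<le> d j" "d j \<le> b j" for j using b_mono[of j "Suc j"] b[of "Suc j"] by (auto simp: d_def)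
  have key: "\<forall>\<^sub>F n in sequentially. 1 \<le> n \<and> 1 \<le> iter_log k (real n) \<and> (\<forall>j. b j * 16 ^ (j * n) \<le> pi * (iter_log k (real n) powr e) ^ n)"
    using eventually_ge_at_top[of "max 1 (nat \<lceil>iter_exp k 1\<rceil>)"]
  proof eventually_elim
    case (elim n)
    have n: "1 \<le> n" "iter_exp k 1 \<le> real n" using elim by auto
    have l: "1 \<le> iter_log k (real n)" using iter_log_ge_1[OF n(2)] by simp
    have l1: "1 \<le> iter_log k (real n) powr e" using l e by (simp add: ge_one_powr_ge_zero)
    have "b j * 16 ^ (j * n) \<le> pi * (iter_log k (real n) powr e) ^ n" for j
    proof (cases "16 ^ j \<le> iter_log k (real n) powr e")
      case True
      have "b j * (16 ^ j) ^ n \<le> pi * (iter_log k (real n) powr e) ^ n"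
        using b[of j] True by (intro mult_mono power_mono) auto
      thus ?thesis by (simp add: power_mult)
    next
      case False
      have "iter_log k (real n) < exp (\<beta> * real j)"
      proof (rule ccontr)
        assume "\<not> ?thesis"
        hence "exp (\<beta> * real j) powr e \<le> iter_log k (real n) powr e" using e by (intro powr_mono2) auto
        moreover have "exp (\<beta> * real j) powr e = 16 ^ j"
          using e by (simp add: \<beta>_def exp_powr_real mult.commute exp_of_nat_mult)
        ultimately show False using False by simp
      qed
      moreover have "E j = iter_exp k (exp (\<beta> * real j))"
        by (simp add: E_def iter_exp_Suc' del: iter_exp_simps)
      ultimately have "real n < E j"
        using iter_log_ge[of k "exp (\<beta> * real j)" "real n"] by (metis not_le)
      hence "3 * real j * real n \<le> 3 * real j * E j" by (intro mult_left_mono) auto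
      moreover have "real (3 * (j * n)) = 3 * real j * real n" by simp
      ultimately have "real (3 * (j * n)) \<le> real (N j)" using N_ge[of j] by linarith
      hence "3 * (j * n) \<le> N j" by (simp only: of_nat_le_iff)
      have "(16::real) ^ (j * n) \<le> (3 ^ 3) ^ (j * n)" by (intro power_mono) auto
      also have "\<dots> = 3 ^ (3 * (j * n))" by (simp add: power_mult)
      also have "\<dots> \<le> 3 ^ N j" using \<open>3 * (j * n) \<le> N j\<close> by (intro power_increasing) auto
      finally have "b j * 16 ^ (j * n) \<le> b j * 3 ^ N j" using b[of j] by (intro mult_left_mono) auto
      also have "\<dots> = pi * 1" by (simp add: b_def)
      also have "\<dots> \<le> pi * (iter_log k (real n) powr e) ^ n"
        using l1 by (intro mult_left_mono one_le_power) auto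
      finally show ?thesis .
    qed
    thus ?case using n l by simp
  qed
  \<comment> \<open>Spending 16 instead of 4 leaves the geometric factor needed for summation over j.\<close>
  have conv: "b j * 4 ^ (j * n) \<le> D * (1 / 4) ^ j" if "b j * 16 ^ (j * n) \<le> D" "1 \<le> n" for n j D
  proof -
    have "(4::real) ^ j * 4 ^ (j * n) \<le> 4 ^ (j * n) * 4 ^ (j * n)"
      using that by (intro mult_right_mono power_increasing) auto
    also have "\<dots> = 16 ^ (j * n)" by (simp flip: power_mult_distrib)
    finally have "b j * (4 ^ j * 4 ^ (j * n)) \<le> b j * 16 ^ (j * n)" using b[of j] by (intro mult_left_mono) auto
    also have "\<dots> \<le> D" by fact
    finally show ?thesis by (simp add: power_one_over field_simps)
  qed
  define T where "T n j t = d j * (R * 4 ^ j) ^ n * \<eta> n (R * (4 ^ j * t - 1))" for n j t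
  have T_bound: "\<bar>T n j t\<bar> \<le> R ^ n * B * (D * (1 / 4) ^ j)"
    if B: "\<And>x. \<bar>\<eta> n x\<bar> \<le> B" and D: "b j * 4 ^ (j * n) \<le> D * (1 / 4) ^ j" for n j t B D
  proof -
    have "\<bar>T n j t\<bar> = d j * (R ^ n * 4 ^ (j * n)) * \<bar>\<eta> n (R * (4 ^ j * t - 1))\<bar>"
      using d[of j] \<eta>(1) by (simp add: T_def abs_mult power_mult_distrib power_mult)
    also have "\<dots> \<le> b j * (R ^ n * 4 ^ (j * n)) * B"
      using d[of j] \<eta>(1) B by (intro mult_mono) auto
    also have "\<dots> = R ^ n * B * (b j * 4 ^ (j * n))" by simp
    also have "\<dots> \<le> R ^ n * B * (D * (1 / 4) ^ j)"
      using D \<eta>(1) order.trans[OF abs_ge_zero B] by (intro mult_left_mono) auto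
    finally show ?thesis .
  qed
  have geo: "summable (\<lambda>j. C * (1 / 4 :: real) ^ j)" for C by (intro summable_mult summable_geometric) auto
  have T_M: "\<exists>M. summable M \<and> (\<forall>j t. norm (T n j t) \<le> M j)" for n
  proof -
    obtain n' where n': "n \<le> n'" "1 \<le> n'" "\<And>j. b j * 16 ^ (j * n') \<le> pi * (iter_log k (real n') powr e) ^ n'"
      using eventually_happens[OF eventually_conj[OF key eventually_ge_at_top[of n]]] by auto
    define D where "D = pi * (iter_log k (real n') powr e) ^ n'"
    have "b j * 4 ^ (j * n) \<le> D * (1 / 4) ^ j" for j
    proof -
      have "b j * 4 ^ (j * n) \<le> b j * 4 ^ (j * n')"
        using b[of j] n' by (intro mult_left_mono power_increasing) auto
      also have "\<dots> \<le> D * (1 / 4) ^ j" using conv n' by (simp add: D_def)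
      finally show ?thesis .
    qed
    moreover obtain B where "\<And>x. \<bar>\<eta> n x\<bar> \<le> B" using \<eta>(6) by blast
    ultimately have "\<bar>T n j t\<bar> \<le> R ^ n * B * D * (1 / 4) ^ j" for j t
      using T_bound[of n B j D t] by (simp add: mult_ac)
    thus ?thesis using geo[of "R ^ n * B * D"] by (intro exI[of _ "\<lambda>j. R ^ n * B * D * (1 / 4) ^ j"]) auto
  qed
  have T_deriv: "(T n j has_real_derivative T (Suc n) j t) (at t)" for n j t
  proof -
    have "((\<lambda>t. \<eta> n (R * (4 ^ j * t - 1))) has_real_derivative \<eta> (Suc n) (R * (4 ^ j * t - 1)) * (R * 4 ^ j)) (at t)"
      by (rule DERIV_chain2[OF \<eta>(3)]) (auto intro!: derivative_eq_intros)
    thus ?thesis unfolding T_def[abs_def] by (auto intro!: derivative_eq_intros)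
  qed
  define \<Psi> where "\<Psi> n t = (\<Sum>j. T n j t)" for n t
  have summ: "summable (\<lambda>j. T n j t)" for n t
    using T_M[of n] by (auto intro: summable_comparison_test')
  have \<Psi>_deriv: "(\<Psi> n has_real_derivative \<Psi> (Suc n) t) (at t)" for n t
    unfolding \<Psi>_def[abs_def]
  proof (rule has_field_derivative_series'(2)[of UNIV])
    obtain M where "summable M" "\<And>j t. norm (T (Suc n) j t) \<le> M j" using T_M by blast
    thus "uniformly_convergent_on UNIV (\<lambda>m x. \<Sum>j<m. T (Suc n) j x)"
      by (intro Weierstrass_m_test') auto
    show "summable (\<lambda>j. T n j 0)" by (rule summ)
  qed (use T_deriv in auto)
  \<comment> \<open>The summand 6 absorbs the factor 4/3 \<pi> from the sum over j.\<close>
  define K' where "K' = R * K + 6"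
  have K': "K' > 0" using \<eta>(1,2) by (simp add: K'_def add_pos_pos)
  have "\<forall>\<^sub>F n in sequentially. \<forall>t. \<bar>\<Psi> n t\<bar> \<le> K' ^ (n + 1) * fact n * weight k s (real n) ^ n"
    using key \<eta>(7) eventually_ge_at_top[of "nat \<lceil>iter_exp k 1\<rceil>"]
  proof eventually_elim
    case (elim n)
    define W where "W = K ^ n * fact n * weight k s' (real n) ^ n"
    define D where "D = pi * (iter_log k (real n) powr e) ^ n"
    have RK: "0 \<le> R * K" using \<eta>(1,2) by simp
    have w: "1 \<le> weight k s (real n)" using elim(3) s by (intro weight_ge_1) auto
    show ?case
    proof
      fix t
      have T1: "\<bar>T n j t\<bar> \<le> R ^ n * W * D * (1 / 4) ^ j" for j
        using T_bound[of n W j D t] elim conv[of j n D] by (simp add: W_def D_def mult_ac)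
      have "\<bar>\<Psi> n t\<bar> \<le> (\<Sum>j. R ^ n * W * D * (1 / 4) ^ j)"
        unfolding \<Psi>_def real_norm_def[symmetric]
        by (rule norm_suminf_le) (use T1 geo in auto)
      also have "\<dots> = R ^ n * W * D * (4 / 3)" by (subst suminf_mult) (auto simp: suminf_geometric)
      also have "\<dots> = (4 / 3 * pi) * ((R * K) ^ n * fact n * (weight k s' (real n) * iter_log k (real n) powr e) ^ n)"
        by (simp add: W_def D_def power_mult_distrib mult_ac)
      also have "weight k s' (real n) * iter_log k (real n) powr e = weight k s (real n)"
        using weight_split[of k "real n" s' e] elim e by simp
      also have "(4 / 3 * pi) * ((R * K) ^ n * fact n * weight k s (real n) ^ n) \<le> K' * (K' ^ n * fact n * weight k s (real n) ^ n)"
        using RK w K' pi_less_4 by (intro mult_mono power_mono) (auto simp: K'_def)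
      finally show "\<bar>\<Psi> n t\<bar> \<le> K' ^ (n + 1) * fact n * weight k s (real n) ^ n" by (simp add: mult_ac)
    qed
  qed
  from refined_gevrey_intro[OF \<Psi>_deriv K' this] have mem: "\<Psi> 0 \<in> refined_gevrey k s" .
  have zero: "\<Psi> 0 t = 0" if "t \<le> 0" for t
  proof -
    have "T 0 j t = 0" for j
    proof -
      have "4 ^ j * t \<le> 0" using that by (simp add: mult_nonneg_nonpos)
      hence "R * (4 ^ j * t - 1) \<le> 0" using \<eta>(1) by (intro mult_nonneg_nonpos) auto
      thus ?thesis using \<eta>(4) by (simp add: T_def)
    qed
    thus ?thesis by (simp add: \<Psi>_def)
  qed
  have plateau: "\<Psi> 0 t = b j" if t: "2 / 4 ^ j \<le> t" "t \<le> 4 / 4 ^ j" for j t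
  proof -
    have t0: "t > 0" using t(1) by (rule less_le_trans[rotated]) simp
    have hi: "T 0 i t = d i" if "j \<le> i" for i
    proof -
      have "2 \<le> 4 ^ j * t" using t(1) by (simp add: field_simps)
      also have "\<dots> \<le> 4 ^ i * t" using that t0 by (intro mult_right_mono power_increasing) auto
      finally have "R * 1 \<le> R * (4 ^ i * t - 1)" using \<eta>(1) by (intro mult_left_mono) auto
      thus ?thesis using \<eta>(5) by (simp add: T_def)
    qed
    have lo: "T 0 i t = 0" if "i < j" for i
    proof -
      have "4 * (4 ^ i * t) \<le> 4 ^ j * t"
        using that t0 power_increasing[of "Suc i" j "4::real"] by (simp add: mult_right_mono flip: mult.assoc)
      also have "\<dots> \<le> 4" using t(2) by (simp add: field_simps)
      finally have "R * (4 ^ i * t - 1) \<le> 0" using \<eta>(1) by (intro mult_nonneg_nonpos) auto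
      thus ?thesis using \<eta>(4) by (simp add: T_def)
    qed
    have "(\<lambda>i. b (i + j) - b (Suc i + j)) sums (b (0 + j) - 0)"
      by (rule telescope_sums'[of "\<lambda>i. b (i + j)"]) (rule LIMSEQ_ignore_initial_segment[OF b_lim])
    hence "(\<lambda>i. T 0 (i + j) t) sums b j" by (simp add: hi d_def)
    hence "(\<lambda>i. T 0 i t) sums (b j + (\<Sum>i<j. T 0 i t))" using sums_iff_shift[of "\<lambda>i. T 0 i t" j "b j"] by simp
    thus ?thesis using lo by (simp add: \<Psi>_def sums_iff)
  qed
  show ?thesis
    by (rule that[of "\<Psi> 0" N \<beta>]) (use mem zero plateau N_mono jN \<beta> N_le in \<open>auto simp: b_def E_def\<close>)
qed

text \<open>
As \<psi> vanishes on the left, the real part of the kernel is (cos (x \<psi>(t)) - 1)/t \<le> 0.  It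
equals -2/t on each plateau, where it integrates to -2 ln 2.
\<close>

lemma stein_wainger_lower_bound:
  assumes \<psi>: "smooth_on {-1..1} \<psi>" and zero: "\<And>t. t \<le> 0 \<Longrightarrow> \<psi> t = 0"
    and plateau: "\<And>j t. 1 \<le> j \<Longrightarrow> j \<le> n \<Longrightarrow> 2 / 4 ^ j \<le> t \<Longrightarrow> t \<le> 4 / 4 ^ j \<Longrightarrow> cos (x * \<psi> t) = -1"
  shows "2 * ln 2 * real n \<le> cmod (stein_wainger \<psi> x)"
proof -
  have cont: "continuous_on {-1..1} \<psi>" using smooth_on_continuous[OF \<psi>, of 0] by simp
  define q where "q t = (1 - cos (x * \<psi> t)) / t" for t
  have q0: "0 \<le> q t" if "t > 0" for t using that by (simp add: q_def)
  have iq: "q integrable_on {a..b}" if "0 < a" "b \<le> 1" for a b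
  proof -
    have "continuous_on {a..b} \<psi>" by (rule continuous_on_subset[OF cont]) (use that in auto)
    thus ?thesis unfolding q_def using that by (auto intro!: integrable_continuous_interval continuous_intros)
  qed
  note comb = Henstock_Kurzweil_Integration.integral_combine
  have main: "2 * ln 2 * real j \<le> integral {1 / 4 ^ j..1} q" if "j \<le> n" for j
    using that
  proof (induction j)
    case (Suc j)
    define u :: real where "u = 1 / 4 ^ Suc j"
    have u: "0 < u" "4 * u = 1 / 4 ^ j" by (auto simp: u_def)
    moreover have "1 / 4 ^ j \<le> (1::real)" by simp
    ultimately have u': "2 * u \<le> 1" "4 * u \<le> 1" by linarith+
    have "integral {u..1} q = integral {u..2*u} q + integral {2*u..4*u} q + integral {4*u..1} q"
      using u comb[where a = u and c = "2*u" and b = "4*u" and f = q]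
        comb[where a = u and c = "4*u" and b = 1 and f = q] iq[of u] u' by simp
    moreover have "0 \<le> integral {u..2*u} q"
      using u(1) u' q0 by (intro integral_nonneg iq) auto
    moreover have "integral {2*u..4*u} q = 2 * ln 2"
    proof -
      have "((\<lambda>t. 2 / t) has_integral (2 * ln (4*u) - 2 * ln (2*u))) {2*u..4*u}"
        using u by (intro fundamental_theorem_of_calculus)
          (auto intro!: derivative_eq_intros simp flip: has_real_derivative_iff_has_vector_derivative)
      moreover have "2 * ln (4*u) - 2 * ln (2*u) = 2 * ln 2"
        using u ln_mult[of 2 "2*u"] by simp
      ultimately have "integral {2*u..4*u} (\<lambda>t. 2 / t) = 2 * ln 2" by (simp add: integral_unique)
      moreover have "integral {2*u..4*u} q = integral {2*u..4*u} (\<lambda>t. 2 / t)"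
      proof (rule integral_cong)
        fix t assume "t \<in> {2*u..4*u}"
        hence "cos (x * \<psi> t) = -1" using Suc.prems by (intro plateau[of "Suc j"]) (auto simp: u_def)
        thus "q t = 2 / t" by (simp add: q_def)
      qed
      ultimately show ?thesis by simp
    qed
    ultimately have "integral {u..1} q \<ge> 2 * ln 2 + integral {1 / 4 ^ j..1} q" using u by simp
    thus ?case using Suc by (simp add: u_def algebra_simps)
  qed simp
  have pos: "0 < 1 / (4::real) ^ n" by simp
  have "\<forall>\<^sub>F \<epsilon> in at_right 0. 2 * ln 2 * real n \<le> cmod (integral {\<epsilon>..1} (fold_kernel \<psi> x))"
    using eventually_at_right_real[OF pos]
  proof eventually_elim
    case (elim \<epsilon>)
    hence \<epsilon>: "0 < \<epsilon>" "\<epsilon> < 1 / 4 ^ n" by auto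
    have n1: "1 / 4 ^ n \<le> (1::real)" by simp
    have iK: "fold_kernel \<psi> x integrable_on {\<epsilon>..1}"
      using \<epsilon> by (intro integrable_continuous_interval continuous_on_fold_kernel cont) auto
    have "2 * ln 2 * real n \<le> integral {1 / 4 ^ n..1} q" using main[of n] by simp
    also have "\<dots> \<le> integral {\<epsilon>..1} q"
      using \<epsilon> n1 q0 by (intro integral_subset_le iq) auto
    also have "\<dots> = integral {\<epsilon>..1} (\<lambda>t. - Re (fold_kernel \<psi> x t))"
      using \<epsilon> by (intro integral_cong) (auto simp: q_def fold_kernel_def zero Re_divide_of_real field_simps)
    also have "\<dots> = - Re (integral {\<epsilon>..1} (fold_kernel \<psi> x))"
      using integral_linear[OF iK bounded_linear_Re] by (simp add: o_def)
    also have "\<dots> \<le> cmod (integral {\<epsilon>..1} (fold_kernel \<psi> x))"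
      using abs_Re_le_cmod[of "integral {\<epsilon>..1} (fold_kernel \<psi> x)"] by linarith
    finally show ?case .
  qed
  thus ?thesis
    by (rule tendsto_lowerbound[OF tendsto_norm[OF stein_wainger_tendsto[OF \<psi>]]]) simp
qed

section \<open>Sharp growth of the oscillatory integral\<close>

theorem theorem1p4:
  fixes k :: nat and s :: real
  assumes "k \<ge> 1" and "s > 1"
  shows "(\<forall>\<psi> \<in> refined_gevrey k s.
            (\<lambda>x. cmod (stein_wainger \<psi> x)) \<in> O[at_top](iter_log (k + 2)))
       \<and> (\<exists>\<psi> \<in> refined_gevrey k s. \<exists>L :: nat \<Rightarrow> real.
            filterlim L at_top sequentially \<and>
            (\<exists>c>0. \<exists>C>0. \<forall>\<^sub>F n in sequentially.
               c * iter_log (k + 2) (L n) \<le> cmod (stein_wainger \<psi> (L n)) \<and>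
               cmod (stein_wainger \<psi> (L n)) \<le> C * iter_log (k + 2) (L n)))"
proof
  show "\<forall>\<psi> \<in> refined_gevrey k s. (\<lambda>x. cmod (stein_wainger \<psi> x)) \<in> O[at_top](iter_log (k + 2))"
    using stein_wainger_bigo assms by blast
next
  obtain \<psi> N \<beta> where \<psi>: "\<psi> \<in> refined_gevrey k s"
    "\<And>t. t \<le> 0 \<Longrightarrow> \<psi> t = 0"
    "\<And>j t. 2 / 4 ^ j \<le> t \<Longrightarrow> t \<le> 4 / 4 ^ j \<Longrightarrow> \<psi> t = pi / 3 ^ N j"
    and N: "mono N" "\<And>j. j \<le> N j" 
    and \<beta>: "\<beta> \<ge> 0" "\<And>j. real (N j) \<le> 3 * real j * iter_exp (k + 1) (\<beta> * real j) + 1"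
    using gevrey_staircase_exists[OF assms] by blast
  have sm: "smooth_on {-1..1} \<psi>" using \<psi>(1) by (simp add: refined_gevrey_def)
  define L :: "nat \<Rightarrow> real" where "L n = 3 ^ N n" for n
  have L: "filterlim L at_top sequentially"
  proof (rule filterlim_at_top_mono[OF filterlim_real_sequentially])
    have "real n \<le> L n" for n
    proof -
      have "real n \<le> 2 ^ n" by (rule less_imp_le[OF of_nat_less_two_power])
      also have "\<dots> \<le> 3 ^ n" by (rule power_mono) auto
      also have "\<dots> \<le> L n" unfolding L_def using N(2) by (intro power_increasing) auto
      finally show ?thesis .
    qed
    thus "\<forall>\<^sub>F n in sequentially. real n \<le> L n" by simp
  qed
  have lower: "2 * ln 2 * real n \<le> cmod (stein_wainger \<psi> (L n))" for n
  proof (rule stein_wainger_lower_bound[OF sm \<psi>(2)])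
    fix j and t :: real assume j: "j \<le> n" and t: "2 / 4 ^ j \<le> t" "t \<le> 4 / 4 ^ j"
    have "L n * \<psi> t = 3 ^ N n / 3 ^ N j * pi" by (simp add: L_def \<psi>(3)[OF t])
    also have "(3::real) ^ N n / 3 ^ N j = 3 ^ (N n - N j)" using monoD[OF N(1) j] by (simp add: power_diff)
    also have "3 ^ (N n - N j) * pi = real (3 ^ (N n - N j)) * pi" by simp
    finally show "cos (L n * \<psi> t) = -1" by (simp only: cos_npi) simp
  qed auto
  have size: "L n \<le> iter_exp (k + 2) (\<beta> * real n + (6 * real n + 2))" for n
  proof -
    define E where "E = iter_exp (k + 1) (\<beta> * real n)"
    have "0 \<le> \<beta> * real n" using \<beta> by simp
    also have "\<dots> \<le> iter_exp k (\<beta> * real n)" by (rule iter_exp_ge)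
    finally have E: "1 \<le> E" by (simp add: E_def)
    have "ln 3 \<le> (2::real)" using ln_le_minus_one[of 3] by simp
    hence "ln (L n) \<le> real (N n) * 2" by (simp add: L_def ln_realpow mult_left_mono)
    also have "\<dots> \<le> (3 * real n * E + 1) * 2" using \<beta>(2)[of n] by (simp add: E_def)
    also have "\<dots> \<le> (6 * real n + 2) * E" using E by (simp add: algebra_simps)
    also have "\<dots> \<le> iter_exp (k + 1) (\<beta> * real n + (6 * real n + 2))"
      unfolding E_def using mult_iter_exp_le[of "\<beta> * real n" "6 * real n + 2" k] \<beta> by simp
    finally have "exp (ln (L n)) \<le> exp (iter_exp (k + 1) (\<beta> * real n + (6 * real n + 2)))" by simp
    thus ?thesis by (simp add: L_def)
  qed
  have "(\<lambda>x. cmod (stein_wainger \<psi> x)) \<in> O[at_top](iter_log (k + 2))"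
    using stein_wainger_bigo[OF \<psi>(1) assms] .
  then obtain C where C: "C > 0" "\<forall>\<^sub>F x in at_top. cmod (stein_wainger \<psi> x) \<le> C * \<bar>iter_log (k + 2) x\<bar>"
    by (elim landau_o.bigE) auto
  have "\<forall>\<^sub>F n in sequentially. iter_exp (k + 2) 0 \<le> L n" using L unfolding filterlim_at_top by blast
  hence "\<forall>\<^sub>F n in sequentially.
      2 * ln 2 / (\<beta> + 8) * iter_log (k + 2) (L n) \<le> cmod (stein_wainger \<psi> (L n)) \<and>
      cmod (stein_wainger \<psi> (L n)) \<le> C * iter_log (k + 2) (L n)"
    using eventually_compose_filterlim[OF C(2) L] eventually_ge_at_top[of 1]
  proof eventually_elim
    case (elim n)
    have l0: "0 \<le> iter_log (k + 2) (L n)" by (rule iter_log_ge) (use elim in auto)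
    have "iter_log (k + 2) (L n) \<le> \<beta> * real n + (6 * real n + 2)"
      by (rule iter_log_le[OF _ size]) (use elim in auto)
    also have "\<dots> \<le> (\<beta> + 8) * real n" using elim by (simp add: algebra_simps)
    finally have "2 * ln 2 / (\<beta> + 8) * iter_log (k + 2) (L n) \<le> 2 * ln 2 / (\<beta> + 8) * ((\<beta> + 8) * real n)"
      using \<beta> by (intro mult_left_mono) auto
    also have "\<dots> = 2 * ln 2 * real n" using \<beta> by simp
    also note lower[of n]
    finally show ?case using elim l0 by simp
  qed
  moreover have "2 * ln 2 / (\<beta> + 8) > 0" using \<beta> by simp
  ultimately show "\<exists>\<psi> \<in> refined_gevrey k s. \<exists>L :: nat \<Rightarrow> real.
            filterlim L at_top sequentially \<and>
            (\<exists>c>0. \<exists>C>0. \<forall>\<^sub>F n in sequentially.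
               c * iter_log (k + 2) (L n) \<le> cmod (stein_wainger \<psi> (L n)) \<and>
               cmod (stein_wainger \<psi> (L n)) \<le> C * iter_log (k + 2) (L n))"
    using \<psi>(1) L C(1) by blast
qed

end
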